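(* (In $\mathbf{ZF}$.) If $\mathbf{X}$ is a Cantor completely metrizable second-countable topological space, then the product space $\mathbf{X}^{\omega}$ (with the product topology) is Loeb.
   Context: The base theory is $\mathbf{ZF}$ (Zermelo–Fraenkel set theory without the axiom of choice). For $A\subseteq X$, $\delta_d(A)$ denotes the diameter of $A$ in a metric space $\langle X,d\rangle$, and $\tau(d)$ is the topology induced by $d$. A metric $d$ on a set $X$ is Cantor complete if, for every sequence $(A_n)_{n\in\omega}$ of non-empty closed subsets of $\langle X,d\rangle$ with $A_{n+1}\subseteq A_n$ for each $n\in\omega$ and $\lim_{n\to\infty}\delta_d(A_n)=0$, the intersection $\bigcap_{n\in\omega}A_n$ is non-empty. A topological space $\langle X,\tau\rangle$ is Cantor completely metrizable if there is a Cantor complete metric $d$ on $X$ with $\tau(d)=\tau$. A topological space is Loeb if it is empty or the collection of all its non-empty closed subsets has a choice function. *)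

theory Defs
  imports Main
begin

text \<open>
  HOL has a global choice operator, so a choice-free theorem is stated about models.  An instance
  of the class \<open>zf\<close> below is a type with a binary relation satisfying the first-order axioms of ZF.
  By the completeness theorem (and downward Loewenheim-Skolem), a first-order sentence is a
  theorem of ZF iff it holds in every such model.  No choice principle is assumed of the model, and
  separation and replacement are restricted to first-order formulas with parameters: the
  schemes for arbitrary HOL predicates would make the model inherit choice from HOL.
\<close>

text \<open>First-order formulas of the language of set theory, with de Bruijn indices.\<close>

datatype fm = Member nat nat | Equal nat nat | Neg fm | Conj fm fm | Forall fm

primrec sat :: "('a \<Rightarrow> 'a \<Rightarrow> bool) \<Rightarrow> fm \<Rightarrow> (nat \<Rightarrow> 'a) \<Rightarrow> bool" where
  "sat E (Member i j) s \<longleftrightarrow> E (s i) (s j)"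
| "sat E (Equal i j) s \<longleftrightarrow> s i = s j"
| "sat E (Neg p) s \<longleftrightarrow> \<not> sat E p s"
| "sat E (Conj p q) s \<longleftrightarrow> sat E p s \<and> sat E q s"
| "sat E (Forall p) s \<longleftrightarrow> (\<forall>x. sat E p (case_nat x s))"

class zf =
  fixes mem :: "'a \<Rightarrow> 'a \<Rightarrow> bool" (infix \<open>\<^bold>\<in>\<close> 50)
  assumes extensionality: "(\<forall>z. z \<^bold>\<in> x \<longleftrightarrow> z \<^bold>\<in> y) \<longrightarrow> x = y"
    and foundation: "(\<exists>y. y \<^bold>\<in> x) \<longrightarrow> (\<exists>y. y \<^bold>\<in> x \<and> \<not> (\<exists>z. z \<^bold>\<in> x \<and> z \<^bold>\<in> y))"
    and pairing: "\<exists>z. \<forall>w. w \<^bold>\<in> z \<longleftrightarrow> w = x \<or> w = y"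
    and union: "\<exists>z. \<forall>w. w \<^bold>\<in> z \<longleftrightarrow> (\<exists>y. y \<^bold>\<in> x \<and> w \<^bold>\<in> y)"
    and power_set: "\<exists>z. \<forall>w. w \<^bold>\<in> z \<longleftrightarrow> (\<forall>v. v \<^bold>\<in> w \<longrightarrow> v \<^bold>\<in> x)"
    and infinity: "\<exists>z. (\<exists>e. e \<^bold>\<in> z \<and> (\<forall>w. \<not> w \<^bold>\<in> e)) \<and>
      (\<forall>x. x \<^bold>\<in> z \<longrightarrow> (\<exists>y. y \<^bold>\<in> z \<and> (\<forall>w. w \<^bold>\<in> y \<longleftrightarrow> w \<^bold>\<in> x \<or> w = x)))"
    and separation: "\<exists>z. \<forall>w. w \<^bold>\<in> z \<longleftrightarrow> w \<^bold>\<in> x \<and> sat (\<^bold>\<in>) p (case_nat w s)"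
    and replacement:
      "(\<forall>u. u \<^bold>\<in> x \<longrightarrow> (\<forall>v w. sat (\<^bold>\<in>) p (case_nat u (case_nat v s)) \<and>
          sat (\<^bold>\<in>) p (case_nat u (case_nat w s)) \<longrightarrow> v = w)) \<longrightarrow>
       (\<exists>z. \<forall>v. v \<^bold>\<in> z \<longleftrightarrow> (\<exists>u. u \<^bold>\<in> x \<and> sat (\<^bold>\<in>) p (case_nat u (case_nat v s))))"

text \<open>
  All notions below are relativized to the model: unbounded quantifiers range over
  elements of the model only, so subsets, families, sequences and functions are always internal
  ones, and \<open>zomega\<close> is the set of natural numbers of the model.
\<close>

definition elts :: "'a::zf \<Rightarrow> 'a set" where
  "elts x = {z. z \<^bold>\<in> x}"

text \<open>Unspecified if no element of the model has extension \<open>S\<close>; below it is applied only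
  to classes that are sets by the axioms of ZF.\<close>

definition the_set :: "'a::zf set \<Rightarrow> 'a" where
  "the_set S = (THE x. elts x = S)"

definition zempty :: "'a::zf" where
  "zempty = the_set {}"

definition upair :: "'a::zf \<Rightarrow> 'a \<Rightarrow> 'a" where
  "upair x y = the_set {x, y}"

definition opair :: "'a::zf \<Rightarrow> 'a \<Rightarrow> 'a" where
  "opair x y = upair (upair x x) (upair x y)"

definition zUnion :: "'a::zf \<Rightarrow> 'a" where
  "zUnion A = the_set (\<Union>x\<in>elts A. elts x)"

definition zInt :: "'a::zf \<Rightarrow> 'a \<Rightarrow> 'a" where
  "zInt x y = the_set (elts x \<inter> elts y)"

definition zDiff :: "'a::zf \<Rightarrow> 'a \<Rightarrow> 'a" where
  "zDiff x y = the_set (elts x - elts y)"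

definition zPow :: "'a::zf \<Rightarrow> 'a" where
  "zPow A = the_set {x. elts x \<subseteq> elts A}"

definition zTimes :: "'a::zf \<Rightarrow> 'a \<Rightarrow> 'a" where
  "zTimes A B = the_set {opair x y | x y. x \<in> elts A \<and> y \<in> elts B}"

definition zsucc :: "'a::zf \<Rightarrow> 'a" where
  "zsucc x = the_set (insert x (elts x))"

definition is_inductive :: "'a::zf \<Rightarrow> bool" where
  "is_inductive I \<longleftrightarrow> zempty \<in> elts I \<and> (\<forall>x\<in>elts I. zsucc x \<in> elts I)"

definition zomega :: "'a::zf" where
  "zomega = the_set {n. \<forall>I. is_inductive I \<longrightarrow> n \<in> elts I}"

definition is_fun :: "'a::zf \<Rightarrow> 'a \<Rightarrow> 'a \<Rightarrow> bool" where
  "is_fun f A B \<longleftrightarrow> elts f \<subseteq> elts (zTimes A B) \<and> (\<forall>x\<in>elts A. \<exists>!y. opair x y \<in> elts f)"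

definition app :: "'a::zf \<Rightarrow> 'a \<Rightarrow> 'a" where
  "app f x = (if \<exists>!y. opair x y \<in> elts f then THE y. opair x y \<in> elts f else zempty)"

abbreviation app2 :: "'a::zf \<Rightarrow> 'a \<Rightarrow> 'a \<Rightarrow> 'a" where
  "app2 f x y \<equiv> app f (opair x y)"

definition is_inj :: "'a::zf \<Rightarrow> 'a \<Rightarrow> 'a \<Rightarrow> bool" where
  "is_inj f A B \<longleftrightarrow> is_fun f A B \<and> inj_on (app f) (elts A)"

definition is_bij :: "'a::zf \<Rightarrow> 'a \<Rightarrow> 'a \<Rightarrow> bool" where
  "is_bij f A B \<longleftrightarrow> is_fun f A B \<and> bij_betw (app f) (elts A) (elts B)"

definition zfinite :: "'a::zf \<Rightarrow> bool" where
  "zfinite A \<longleftrightarrow> (\<exists>n\<in>elts zomega. \<exists>f. is_bij f n A)"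

definition zcountable :: "'a::zf \<Rightarrow> bool" where
  "zcountable A \<longleftrightarrow> (\<exists>f. is_inj f A zomega)"

definition is_choice_function :: "'a::zf \<Rightarrow> 'a \<Rightarrow> bool" where
  "is_choice_function c A \<longleftrightarrow> is_fun c A (zUnion A) \<and> (\<forall>x\<in>elts A. app c x \<in> elts x)"

definition is_topology :: "'a::zf \<Rightarrow> 'a \<Rightarrow> bool" where
  "is_topology X T \<longleftrightarrow>
     (\<forall>U\<in>elts T. elts U \<subseteq> elts X) \<and> zempty \<in> elts T \<and> X \<in> elts T \<and>
     (\<forall>U\<in>elts T. \<forall>V\<in>elts T. zInt U V \<in> elts T) \<and>
     (\<forall>S. elts S \<subseteq> elts T \<longrightarrow> zUnion S \<in> elts T)"

definition is_base :: "'a::zf \<Rightarrow> 'a \<Rightarrow> bool" where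
  "is_base B T \<longleftrightarrow> elts B \<subseteq> elts T \<and> (\<forall>U\<in>elts T. \<exists>S. elts S \<subseteq> elts B \<and> zUnion S = U)"

definition second_countable :: "'a::zf \<Rightarrow> bool" where
  "second_countable T \<longleftrightarrow> (\<exists>B. is_base B T \<and> zcountable B)"

definition is_closed :: "'a::zf \<Rightarrow> 'a \<Rightarrow> 'a \<Rightarrow> bool" where
  "is_closed X T F \<longleftrightarrow> elts F \<subseteq> elts X \<and> zDiff X F \<in> elts T"

definition loeb :: "'a::zf \<Rightarrow> 'a \<Rightarrow> bool" where
  "loeb X T \<longleftrightarrow> X = zempty \<or>
     (\<exists>c. is_choice_function c (the_set {F. is_closed X T F \<and> F \<noteq> zempty}))"

definition omega_power :: "'a::zf \<Rightarrow> 'a" where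
  "omega_power X = the_set {f. is_fun f zomega X}"

definition box :: "'a::zf \<Rightarrow> 'a \<Rightarrow> 'a" where
  "box X V = the_set {f. is_fun f zomega X \<and> (\<forall>n\<in>elts zomega. app f n \<in> elts (app V n))}"

definition is_box_family :: "'a::zf \<Rightarrow> 'a \<Rightarrow> 'a \<Rightarrow> bool" where
  "is_box_family X T V \<longleftrightarrow>
     is_fun V zomega T \<and> zfinite (the_set {n\<in>elts zomega. app V n \<noteq> X})"

definition product_topology :: "'a::zf \<Rightarrow> 'a \<Rightarrow> 'a" where
  "product_topology X T = the_set {U. elts U \<subseteq> elts (omega_power X) \<and>
     (\<forall>f\<in>elts U. \<exists>V. is_box_family X T V \<and> f \<in> elts (box X V) \<and> elts (box X V) \<subseteq> elts U)}"

text \<open>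
  The real numbers enter as an arbitrary Dedekind complete ordered field of the model; ZF
  proves that there is one and that it is unique up to isomorphism.
\<close>

record 'a ofield =
  rcar :: 'a
  radd :: 'a
  rmul :: 'a
  rleq :: 'a
  rzero :: 'a
  rone :: 'a

abbreviation rle :: "'a::zf ofield \<Rightarrow> 'a \<Rightarrow> 'a \<Rightarrow> bool" where
  "rle R x y \<equiv> opair x y \<in> elts (rleq R)"

abbreviation rless :: "'a::zf ofield \<Rightarrow> 'a \<Rightarrow> 'a \<Rightarrow> bool" where
  "rless R x y \<equiv> rle R x y \<and> x \<noteq> y"

definition is_lub :: "'a::zf ofield \<Rightarrow> 'a set \<Rightarrow> 'a \<Rightarrow> bool" where
  "is_lub R S r \<longleftrightarrow> r \<in> elts (rcar R) \<and> (\<forall>x\<in>S. rle R x r) \<and>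
     (\<forall>u\<in>elts (rcar R). (\<forall>x\<in>S. rle R x u) \<longrightarrow> rle R r u)"

definition is_ordered_field :: "'a::zf ofield \<Rightarrow> bool" where
  "is_ordered_field R \<longleftrightarrow>
     (let K = elts (rcar R); a = app2 (radd R); m = app2 (rmul R); z = rzero R; e = rone R in
       is_fun (radd R) (zTimes (rcar R) (rcar R)) (rcar R) \<and>
       is_fun (rmul R) (zTimes (rcar R) (rcar R)) (rcar R) \<and>
       z \<in> K \<and> e \<in> K \<and> z \<noteq> e \<and>
       (\<forall>x\<in>K. \<forall>y\<in>K. \<forall>w\<in>K. a (a x y) w = a x (a y w)) \<and>
       (\<forall>x\<in>K. \<forall>y\<in>K. a x y = a y x) \<and>
       (\<forall>x\<in>K. a z x = x) \<and>
       (\<forall>x\<in>K. \<exists>y\<in>K. a x y = z) \<and>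
       (\<forall>x\<in>K. \<forall>y\<in>K. \<forall>w\<in>K. m (m x y) w = m x (m y w)) \<and>
       (\<forall>x\<in>K. \<forall>y\<in>K. m x y = m y x) \<and>
       (\<forall>x\<in>K. m e x = x) \<and>
       (\<forall>x\<in>K. x \<noteq> z \<longrightarrow> (\<exists>y\<in>K. m x y = e)) \<and>
       (\<forall>x\<in>K. \<forall>y\<in>K. \<forall>w\<in>K. m x (a y w) = a (m x y) (m x w)) \<and>
       elts (rleq R) \<subseteq> elts (zTimes (rcar R) (rcar R)) \<and>
       (\<forall>x\<in>K. \<forall>y\<in>K. rle R x y \<or> rle R y x) \<and>
       (\<forall>x\<in>K. \<forall>y\<in>K. rle R x y \<and> rle R y x \<longrightarrow> x = y) \<and>
       (\<forall>x\<in>K. \<forall>y\<in>K. \<forall>w\<in>K. rle R x y \<and> rle R y w \<longrightarrow> rle R x w) \<and>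
       (\<forall>x\<in>K. \<forall>y\<in>K. \<forall>w\<in>K. rle R x y \<longrightarrow> rle R (a x w) (a y w)) \<and>
       (\<forall>x\<in>K. \<forall>y\<in>K. rle R z x \<and> rle R z y \<longrightarrow> rle R z (m x y)))"

definition is_reals :: "'a::zf ofield \<Rightarrow> bool" where
  "is_reals R \<longleftrightarrow> is_ordered_field R \<and>
     (\<forall>S. elts S \<subseteq> elts (rcar R) \<and> elts S \<noteq> {} \<and>
        (\<exists>u\<in>elts (rcar R). \<forall>x\<in>elts S. rle R x u) \<longrightarrow> (\<exists>r. is_lub R (elts S) r))"

definition is_metric :: "'a::zf ofield \<Rightarrow> 'a \<Rightarrow> 'a \<Rightarrow> bool" where
  "is_metric R X d \<longleftrightarrow> is_fun d (zTimes X X) (rcar R) \<and>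
     (\<forall>x\<in>elts X. \<forall>y\<in>elts X. rle R (rzero R) (app2 d x y)) \<and>
     (\<forall>x\<in>elts X. \<forall>y\<in>elts X. app2 d x y = rzero R \<longleftrightarrow> x = y) \<and>
     (\<forall>x\<in>elts X. \<forall>y\<in>elts X. app2 d x y = app2 d y x) \<and>
     (\<forall>x\<in>elts X. \<forall>y\<in>elts X. \<forall>w\<in>elts X.
        rle R (app2 d x w) (app2 (radd R) (app2 d x y) (app2 d y w)))"

definition metric_topology :: "'a::zf ofield \<Rightarrow> 'a \<Rightarrow> 'a \<Rightarrow> 'a" where
  "metric_topology R X d = the_set {U. elts U \<subseteq> elts X \<and>
     (\<forall>x\<in>elts U. \<exists>r\<in>elts (rcar R). rless R (rzero R) r \<and>
        (\<forall>y\<in>elts X. rless R (app2 d x y) r \<longrightarrow> y \<in> elts U))}"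

definition is_diameter :: "'a::zf ofield \<Rightarrow> 'a \<Rightarrow> 'a \<Rightarrow> 'a \<Rightarrow> bool" where
  "is_diameter R d A r \<longleftrightarrow> is_lub R {app2 d x y | x y. x \<in> elts A \<and> y \<in> elts A} r"

text \<open>
  Only bounded sets have a diameter, so the limit includes finiteness of almost all diameters.
  On \<open>zomega\<close>, the relation \<open>elts m \<subseteq> elts n\<close> is the usual order.\<close>

definition diameters_tendsto_zero :: "'a::zf ofield \<Rightarrow> 'a \<Rightarrow> 'a \<Rightarrow> bool" where
  "diameters_tendsto_zero R d A \<longleftrightarrow>
     (\<forall>e\<in>elts (rcar R). rless R (rzero R) e \<longrightarrow>
        (\<exists>m\<in>elts zomega. \<forall>n\<in>elts zomega. elts m \<subseteq> elts n \<longrightarrow>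
           (\<exists>r. is_diameter R d (app A n) r \<and> rless R r e)))"

definition cantor_complete :: "'a::zf ofield \<Rightarrow> 'a \<Rightarrow> 'a \<Rightarrow> bool" where
  "cantor_complete R X d \<longleftrightarrow>
     (\<forall>A. is_fun A zomega (zPow X) \<and>
        (\<forall>n\<in>elts zomega. app A n \<noteq> zempty \<and> is_closed X (metric_topology R X d) (app A n) \<and>
           elts (app A (zsucc n)) \<subseteq> elts (app A n)) \<and>
        diameters_tendsto_zero R d A \<longrightarrow>
        (\<Inter>n\<in>elts zomega. elts (app A n)) \<noteq> {})"

definition cantor_completely_metrizable :: "'a::zf \<Rightarrow> 'a \<Rightarrow> bool" where
  "cantor_completely_metrizable X T \<longleftrightarrow>
     (\<exists>R d. is_reals R \<and> is_metric R X d \<and> cantor_complete R X d \<and> metric_topology R X d = T)"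

end

(* Let F be a nonempty closed subset of X^omega. Cut F down in omega many steps so that each coordinate
   is treated infinitely often with arbitrarily small precision: at step j keep those f in S_j whose
   e(j)-th coordinate lies in the first basic set U with all distances below h(j) for which this
   leaves something. No choice is needed, as the countable base is enumerated and S_{j+1} depends only on S_j.
   For each n the closures of the n-th projections of the S_j are nonempty, decreasing closed
   sets with diameters tending to 0, so they meet in exactly one point x_n. Every basic
   neighbourhood of x = (x_n) involves finitely many coordinates and hence contains some S_j, which
   is a nonempty part of F; so x is in F. The point x is given by a first-order formula in F, so
   separation turns F |-> x into a choice function in the model. *)

theory Submission
  imports Defs
begin

section \<open>Definable predicates and terms\<close>

text \<open>The obstacle is definability. Separation covers only formulas with parameters, and
  \<open>zomega\<close> may have nonstandard elements, so HOL sets, recursion and induction cannot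
  be transferred to the model: every set, function and induction hypothesis must be certified as
  first-order definable. \<open>def_pred\<close> and \<open>def_term\<close> do this semantically,
  with closure rules collected in \<open>definable\<close>, so that formulas are written out only
  for the basic rules. The second concern is uniqueness. Cantor completeness gives only the
  existence of each limit coordinate, and infinitely many existence statements do not combine into
  one function without choice; shrinking distances make each limit unique, so the map from
  \<open>n\<close> to \<open>x_n\<close> is given by a formula. The cuts are made in the product,
  not separately in each coordinate, because finitely many coordinates of \<open>x\<close> have to
  be approximated by one common member of \<open>F\<close>.\<close>

primrec rename :: "(nat \<Rightarrow> nat) \<Rightarrow> fm \<Rightarrow> fm" where
  "rename f (Member i j) = Member (f i) (f j)"
| "rename f (Equal i j) = Equal (f i) (f j)"
| "rename f (Neg p) = Neg (rename f p)"
| "rename f (Conj p q) = Conj (rename f p) (rename f q)"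
| "rename f (Forall p) = Forall (rename (case_nat 0 (\<lambda>n. Suc (f n))) p)"

lemma sat_rename: "sat E (rename f p) s \<longleftrightarrow> sat E p (\<lambda>n. s (f n))"
proof (induction p arbitrary: f s)
  case (Forall p)
  have "(\<lambda>n. case_nat x s (case_nat 0 (\<lambda>n. Suc (f n)) n)) = case_nat x (\<lambda>n. s (f n))" for x
    by (auto split: nat.split)
  then show ?case by (simp add: Forall)
qed auto

text \<open>The numbers of arguments and of parameters are not bounded in advance, so both are kept
  as infinite sequences and interleaved into one valuation.\<close>

definition mix :: "(nat \<Rightarrow> 'a) \<Rightarrow> (nat \<Rightarrow> 'a) \<Rightarrow> nat \<Rightarrow> 'a" where
  "mix s t n = (if even n then s (n div 2) else t (n div 2))"

lemma mix_even: "mix s t (2 * n) = s n" and mix_odd: "mix s t (2 * n + 1) = t n"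
  by (simp_all add: mix_def)

text \<open>The even variables are the arguments and the odd ones hold the parameters \<open>t\<close>.\<close>

definition def_pred :: "((nat \<Rightarrow> 'a::zf) \<Rightarrow> bool) \<Rightarrow> bool" where
  "def_pred P \<longleftrightarrow> (\<exists>p t. \<forall>s. P s \<longleftrightarrow> sat (\<^bold>\<in>) p (mix s t))"

text \<open>The language has no function symbols, so a term is represented by its graph: variable 0
  is the value, the other variables are the arguments.\<close>

definition def_term :: "((nat \<Rightarrow> 'a::zf) \<Rightarrow> 'a) \<Rightarrow> bool" where
  "def_term F \<longleftrightarrow> def_pred (\<lambda>s. s 0 = F (\<lambda>n. s (Suc n)))"

named_theorems definable

lemma def_pred_rename:
  assumes "def_pred P" shows "def_pred (\<lambda>s. P (\<lambda>n. s (f n)))"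
proof -
  obtain p t where pt: "\<And>s. P s \<longleftrightarrow> sat (\<^bold>\<in>) p (mix s t)"
    using assms unfolding def_pred_def by blast
  let ?g = "\<lambda>n. if even n then 2 * f (n div 2) else n"
  have "mix (\<lambda>n. s (f n)) t = (\<lambda>n. mix s t (?g n))" for s
    by (rule ext) (auto simp: mix_def)
  then have "P (\<lambda>n. s (f n)) \<longleftrightarrow> sat (\<^bold>\<in>) (rename ?g p) (mix s t)" for s
    by (simp add: pt sat_rename)
  then show ?thesis unfolding def_pred_def by blast
qed

lemma def_pred_not [definable]: "def_pred P \<Longrightarrow> def_pred (\<lambda>s. \<not> P s)"
  unfolding def_pred_def by (metis sat.simps(3))

lemma def_pred_conj [definable]:
  assumes "def_pred P" "def_pred Q" shows "def_pred (\<lambda>s. P s \<and> Q s)"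
proof -
  obtain p t where pt: "\<And>s. P s \<longleftrightarrow> sat (\<^bold>\<in>) p (mix s t)"
    using assms(1) unfolding def_pred_def by blast
  obtain q u where qu: "\<And>s. Q s \<longleftrightarrow> sat (\<^bold>\<in>) q (mix s u)"
    using assms(2) unfolding def_pred_def by blast
  \<comment> \<open>\<open>p\<close> and \<open>q\<close> bring different parameters
    \<open>t\<close> and \<open>u\<close>, merged here as \<open>mix t u\<close>: parameter
    \<open>k\<close> moves to \<open>2 * k\<close> for \<open>p\<close> and to
    \<open>2 * k + 1\<close> for \<open>q\<close>.\<close>
  let ?f = "\<lambda>n. if even n then n else 2 * (2 * (n div 2)) + 1"
  let ?g = "\<lambda>n. if even n then n else 2 * (2 * (n div 2) + 1) + 1"
  have "mix s t n = mix s (mix t u) (?f n) \<and> mix s u n = mix s (mix t u) (?g n)" for s n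
  proof (cases "even n")
    case True
    then show ?thesis by (simp add: mix_def)
  next
    case False
    then obtain k where "n = 2 * k + 1" by (rule oddE)
    then have "?f n = 2 * (2 * k) + 1" "?g n = 2 * (2 * k + 1) + 1" "n = 2 * k + 1"
      by simp_all
    then show ?thesis by (simp only: mix_odd mix_even)
  qed
  then have *: "mix s t = (\<lambda>n. mix s (mix t u) (?f n))"
      "mix s u = (\<lambda>n. mix s (mix t u) (?g n))" for s
    by blast+
  have "P s \<and> Q s \<longleftrightarrow> sat (\<^bold>\<in>) (Conj (rename ?f p) (rename ?g q)) (mix s (mix t u))" for s
    by (simp only: pt qu sat.simps sat_rename *[symmetric])
  then show ?thesis unfolding def_pred_def by blast
qed

text \<open>A new argument shifts the old arguments by two places in the interleaving and leaves the
  parameters in place, whereas a quantifier shifts everything by one. Hence even positions go back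
  by one and odd ones forward by one.\<close>

lemma mix_case_nat:
  "mix (case_nat x s) t =
    (\<lambda>n. case_nat x (mix s t) (if n = 0 then 0 else if even n then n - 1 else Suc n))"
proof
  fix n
  consider "n = 0" | k where "n = 2 * Suc k" | k where "n = 2 * k + 1"
    by (metis evenE oddE not0_implies_Suc mult_0_right)
  then show "mix (case_nat x s) t n =
    case_nat x (mix s t) (if n = 0 then 0 else if even n then n - 1 else Suc n)"
  proof cases
    case (2 k)
    have "2 * Suc k div 2 = Suc k" "2 * Suc k - 1 = Suc (2 * k)" by simp_all
    then show ?thesis unfolding 2 mix_def by simp
  next
    case (3 k)
    have "(2 * k + 1) div 2 = k" "Suc (2 * k + 1) = Suc (Suc (2 * k))" by simp_all
    then show ?thesis unfolding 3 mix_def by simp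
  qed (simp add: mix_def)
qed

lemma def_pred_all [definable]:
  assumes "def_pred (\<lambda>s. P (s 0) (\<lambda>n. s (Suc n)))" shows "def_pred (\<lambda>s. \<forall>x. P x s)"
proof -
  obtain p t where pt: "\<And>s. P (s 0) (\<lambda>n. s (Suc n)) \<longleftrightarrow> sat (\<^bold>\<in>) p (mix s t)"
    using assms unfolding def_pred_def by blast
  let ?f = "\<lambda>n. if n = 0 then 0 else if even n then n - 1 else Suc n"
  have "P x s \<longleftrightarrow> sat (\<^bold>\<in>) (rename ?f p) (case_nat x (mix s t))" for x s
    using pt[of "case_nat x s"] by (simp add: sat_rename mix_case_nat)
  then have "(\<forall>x. P x s) \<longleftrightarrow> sat (\<^bold>\<in>) (Forall (rename ?f p)) (mix s t)" for s
    by simp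
  then show ?thesis unfolding def_pred_def by blast
qed

section \<open>Atomic formulas, derived connectives and substitution of terms\<close>

lemma def_pred_mem_var: "def_pred (\<lambda>s. s i \<^bold>\<in> s j)"
  unfolding def_pred_def
  by (rule exI[of _ "Member (2 * i) (2 * j)"]) (simp add: mix_def)

lemma def_pred_eq_var: "def_pred (\<lambda>s. s i = s j)"
  unfolding def_pred_def
  by (rule exI[of _ "Equal (2 * i) (2 * j)"]) (simp add: mix_def)

lemma def_pred_eq_const: "def_pred (\<lambda>s. s i = a)"
  unfolding def_pred_def
  by (rule exI[of _ "Equal (2 * i) 1"], rule exI[of _ "\<lambda>_. a"]) (simp add: mix_def)

lemma def_pred_const [definable]: "def_pred (\<lambda>s. b)"
proof -
  have "def_pred (\<lambda>s. s 0 = s 0)" "def_pred (\<lambda>s. \<not> s 0 = s 0)"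
    by (intro definable def_pred_eq_var)+
  then show ?thesis by (cases b) simp_all
qed

lemma def_pred_imp [definable]:
  assumes "def_pred P" "def_pred Q" shows "def_pred (\<lambda>s. P s \<longrightarrow> Q s)"
proof -
  have "def_pred (\<lambda>s. \<not> (P s \<and> \<not> Q s))" by (intro definable assms)
  then show ?thesis by simp
qed

lemma def_pred_disj [definable]:
  assumes "def_pred P" "def_pred Q" shows "def_pred (\<lambda>s. P s \<or> Q s)"
proof -
  have "def_pred (\<lambda>s. \<not> P s \<longrightarrow> Q s)" by (intro definable assms)
  then show ?thesis by (simp add: disj_imp)
qed

lemma def_pred_iff [definable]:
  assumes "def_pred P" "def_pred Q" shows "def_pred (\<lambda>s. P s \<longleftrightarrow> Q s)"
proof -
  have "def_pred (\<lambda>s. (P s \<longrightarrow> Q s) \<and> (Q s \<longrightarrow> P s))" by (intro definable assms)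
  then show ?thesis by (simp add: iff_conv_conj_imp)
qed

lemma def_pred_ex [definable]:
  assumes "def_pred (\<lambda>s. P (s 0) (\<lambda>n. s (Suc n)))" shows "def_pred (\<lambda>s. \<exists>x. P x s)"
proof -
  have "def_pred (\<lambda>s. \<not> (\<forall>x. \<not> P x s))" by (intro definable assms)
  then show ?thesis by simp
qed

text \<open>The usual elimination of terms: an auxiliary bound variable is required to equal
  \<open>F s\<close>.\<close>

lemma def_pred_subst:
  assumes "def_pred (\<lambda>s. P (s 0) (\<lambda>n. s (Suc n)))" "def_term F"
  shows "def_pred (\<lambda>s. P (F s) s)"
proof -
  have "def_pred (\<lambda>s. \<exists>x. x = F s \<and> P x s)"
    by (intro definable assms(1) assms(2)[unfolded def_term_def])
  then show ?thesis by simp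
qed

lemma def_term_rename:
  assumes "def_term F" shows "def_term (\<lambda>s. F (\<lambda>n. s (f n)))"
  using def_pred_rename[OF assms[unfolded def_term_def], of "case_nat 0 (\<lambda>n. Suc (f n))"]
  by (simp add: def_term_def)

lemma def_pred_subst1:
  "def_pred (\<lambda>s. P (s 0)) \<Longrightarrow> def_term F \<Longrightarrow> def_pred (\<lambda>s. P (F s))"
  using def_pred_subst[of "\<lambda>x s. P x"] by simp

lemma def_pred_subst2:
  assumes "def_pred (\<lambda>s. P (s 0) (s (Suc 0)))" "def_term F" "def_term G"
  shows "def_pred (\<lambda>s. P (F s) (G s))"
proof -
  \<comment> \<open>\<open>def_pred_subst\<close> replaces variable 0 only, so the variables are
    permuted to bring each argument there in turn.\<close>
  have "def_pred (\<lambda>s. P (s (Suc 0)) (s 0))"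
    using def_pred_rename[OF assms(1), of "\<lambda>n. if n = 0 then Suc 0 else 0"] by simp
  then have "def_pred (\<lambda>s. P (s 0) (G (\<lambda>n. s (Suc n))))"
    using def_pred_subst[of "\<lambda>x s. P (s 0) x" "\<lambda>s. G (\<lambda>n. s (Suc n))"]
      def_term_rename[OF assms(3)] by simp
  then show ?thesis using def_pred_subst[of "\<lambda>x s. P x (G s)"] assms(2) by simp
qed

lemma def_pred_subst3:
  assumes "def_pred (\<lambda>s. P (s 0) (s (Suc 0)) (s (Suc (Suc 0))))" "def_term F" "def_term G" "def_term H"
  shows "def_pred (\<lambda>s. P (F s) (G s) (H s))"
proof -
  have "def_pred (\<lambda>s. P (s (Suc 0)) (s (Suc (Suc 0))) (s 0))"
    using def_pred_rename[OF assms(1), of "case_nat (Suc 0) (case_nat (Suc (Suc 0)) (\<lambda>_. 0))"]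
    by simp
  then have "def_pred (\<lambda>s. P (s 0) (s (Suc 0)) (H (\<lambda>n. s (Suc (Suc n)))))"
    using def_pred_subst[of "\<lambda>x s. P (s 0) (s (Suc 0)) x" "\<lambda>s. H (\<lambda>n. s (Suc (Suc n)))"]
      def_term_rename[OF assms(4), of "\<lambda>n. Suc (Suc n)"] by simp
  from def_pred_rename[OF this, of "\<lambda>n. if n = 0 then Suc 0 else if n = Suc 0 then 0 else n"]
  have "def_pred (\<lambda>s. P (s (Suc 0)) (s 0) (H (\<lambda>n. s (Suc (Suc n)))))" by simp
  then have "def_pred (\<lambda>s. P (s 0) (G (\<lambda>n. s (Suc n))) (H (\<lambda>n. s (Suc n))))"
    using def_pred_subst[of "\<lambda>x s. P (s 0) x (H (\<lambda>n. s (Suc n)))" "\<lambda>s. G (\<lambda>n. s (Suc n))"]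
      def_term_rename[OF assms(3)] by simp
  then show ?thesis using def_pred_subst[of "\<lambda>x s. P x (G s) (H s)"] assms(2) by simp
qed

lemma def_term_var [definable]: "def_term (\<lambda>s. s i)"
  unfolding def_term_def by (rule def_pred_eq_var)

lemma def_term_const [definable]: "def_term (\<lambda>s. a)"
  unfolding def_term_def by (rule def_pred_eq_const)

lemma def_pred_eq [definable]:
  "def_term F \<Longrightarrow> def_term G \<Longrightarrow> def_pred (\<lambda>s. F s = G s)"
  by (rule def_pred_subst2[where P = "(=)", OF def_pred_eq_var])

lemma def_pred_mem [definable]:
  "def_term F \<Longrightarrow> def_term G \<Longrightarrow> def_pred (\<lambda>s. F s \<in> elts (G s))"
  unfolding elts_def mem_Collect_eq by (rule def_pred_subst2[where P = "(\<^bold>\<in>)", OF def_pred_mem_var])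

lemma def_term_subst1:
  assumes "def_term (\<lambda>s. T (s 0))" "def_term F" shows "def_term (\<lambda>s. T (F s))"
proof -
  have "def_pred (\<lambda>s. s 0 = T (s (Suc 0)))" using assms(1) unfolding def_term_def .
  from def_pred_subst2[where P = "\<lambda>x y. x = T y", OF this def_term_var
      def_term_rename[OF assms(2), of Suc]]
  show ?thesis unfolding def_term_def .
qed

lemma def_term_subst2:
  assumes "def_term (\<lambda>s. T (s 0) (s (Suc 0)))" "def_term F" "def_term G"
  shows "def_term (\<lambda>s. T (F s) (G s))"
proof -
  have "def_pred (\<lambda>s. s 0 = T (s (Suc 0)) (s (Suc (Suc 0))))"
    using assms(1) unfolding def_term_def .
  from def_pred_subst3[where P = "\<lambda>x y z. x = T y z", OF this def_term_var
      def_term_rename[OF assms(2), of Suc] def_term_rename[OF assms(3), of Suc]]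
  show ?thesis unfolding def_term_def .
qed

lemma def_pred_ball [definable]:
  assumes "def_term A" "def_pred (\<lambda>s. P (s 0) (\<lambda>n. s (Suc n)))"
  shows "def_pred (\<lambda>s. \<forall>x\<in>elts (A s). P x s)"
  unfolding Ball_def by (intro definable assms def_term_rename[OF assms(1)])

lemma def_pred_bex [definable]:
  assumes "def_term A" "def_pred (\<lambda>s. P (s 0) (\<lambda>n. s (Suc n)))"
  shows "def_pred (\<lambda>s. \<exists>x\<in>elts (A s). P x s)"
  unfolding Bex_def by (intro definable assms def_term_rename[OF assms(1)])

lemma def_pred_ex1 [definable]:
  assumes "def_pred (\<lambda>s. P (s 0) (\<lambda>n. s (Suc n)))"
  shows "def_pred (\<lambda>s. \<exists>!x. P x s)"
proof -
  have "def_pred (\<lambda>s. P (s 0) (\<lambda>n. s (Suc (Suc n))))"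
    using def_pred_rename[OF assms, of "case_nat 0 (\<lambda>n. Suc (Suc n))"] by simp
  then show ?thesis unfolding Ex1_def by (intro definable assms)
qed

lemma def_pred_subset [definable]:
  assumes "def_term F" "def_term G" shows "def_pred (\<lambda>s. elts (F s) \<subseteq> elts (G s))"
  unfolding subset_iff by (intro definable def_term_rename[OF assms(1)] def_term_rename[OF assms(2)])

section \<open>Definability of comprehension terms\<close>

lemma elts_inject: "elts x = elts y \<longleftrightarrow> x = y"
  using extensionality[of x y] by (auto simp: elts_def)

lemma elts_the_set: "\<exists>z. elts z = S \<Longrightarrow> elts (the_set S) = S"
  unfolding the_set_def by (rule theI') (metis elts_inject)

lemma the_set_elts [simp]: "the_set (elts x) = x"
  using elts_the_set[of "elts x"] elts_inject by auto

text \<open>For a collection that is not the extension of any element, \<open>the_set\<close> takes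
  the value \<open>THE x. False\<close>, always the same element. A case distinction with this
  element as a parameter makes the term definable before the collection is known to be a
  set.\<close>

lemma def_term_the_set [definable]:
  assumes "def_pred (\<lambda>s. P (s 0) (\<lambda>n. s (Suc n)))"
  shows "def_term (\<lambda>s. the_set {x. P x s})"
proof -
  have *: "y = the_set {x. P x s} \<longleftrightarrow> (\<forall>x. x \<in> elts y \<longleftrightarrow> P x s) \<or>
      \<not> (\<exists>y. \<forall>x. x \<in> elts y \<longleftrightarrow> P x s) \<and> y = (THE x. False)" for y s
  proof (cases "\<exists>y. elts y = {x. P x s}")
    case True
    then obtain z where z: "elts z = {x. P x s}" by blast
    then have "the_set {x. P x s} = z" using the_set_elts[of z] by simp
    then show ?thesis using z elts_inject[of y z] by blast
  next
    case False
    then have "the_set {x. P x s} = (THE x. False)" unfolding the_set_def by simp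
    then show ?thesis using False by auto
  qed
  have "def_pred (\<lambda>s. P (s 0) (\<lambda>n. s (Suc (Suc n))))"
    and "def_pred (\<lambda>s. P (s 0) (\<lambda>n. s (Suc (Suc (Suc n)))))"
    using def_pred_rename[OF assms, of "case_nat 0 (\<lambda>n. Suc (Suc n))"]
      def_pred_rename[OF assms, of "case_nat 0 (\<lambda>n. Suc (Suc (Suc n)))"] by simp_all
  then show ?thesis unfolding def_term_def * by (intro definable)
qed

lemma def_term_if [definable]:
  assumes "def_pred P" "def_term F" "def_term G"
  shows "def_term (\<lambda>s. if P s then F s else G s)"
proof -
  have *: "y = (if P s then F s else G s) \<longleftrightarrow> P s \<and> y = F s \<or> \<not> P s \<and> y = G s" for y s
    by simp
  have "def_pred (\<lambda>s. P (\<lambda>n. s (Suc n)))" by (rule def_pred_rename[OF assms(1)])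
  then show ?thesis unfolding def_term_def *
    by (intro definable def_term_rename[OF assms(2)] def_term_rename[OF assms(3)])
qed

section \<open>Elementary set theory in the model\<close>

lemma separation':
  assumes "def_pred (\<lambda>s. P (s 0))" shows "\<exists>z. elts z = {w \<in> elts x. P w}"
proof -
  obtain p t where pt: "\<And>s. P (s 0) \<longleftrightarrow> sat (\<^bold>\<in>) p (mix s t)"
    using assms unfolding def_pred_def by blast
  let ?f = "\<lambda>n. if n = 0 then 0 else if even n then n - 1 else Suc n"
  \<comment> \<open>\<open>t\<close> also fills the argument places, which is harmless because
    \<open>P\<close> looks at variable 0 only.\<close>
  have "P w \<longleftrightarrow> sat (\<^bold>\<in>) (rename ?f p) (case_nat w (mix t t))" for w
    using pt[of "case_nat w t"] by (simp add: sat_rename mix_case_nat)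
  with separation[of x "rename ?f p" "mix t t"] show ?thesis
    by (auto simp: elts_def)
qed

text \<open>The standard way to show that a notion introduced by \<open>the_set\<close> has the
  intended elements: a definable property together with any bounding set \<open>x\<close>.\<close>

lemma elts_the_set_sep:
  assumes "def_pred (\<lambda>s. P (s 0))" "\<And>w. P w \<Longrightarrow> w \<in> elts x"
  shows "elts (the_set {w. P w}) = {w. P w}"
proof -
  have "{w. P w} = {w \<in> elts x. P w}" using assms(2) by auto
  then show ?thesis using separation'[OF assms(1), of x] elts_the_set by metis
qed

lemma elts_zempty [simp]: "elts zempty = {}"
proof -
  have "\<exists>z::'a. elts z = {w \<in> elts undefined. False}" by (intro separation' definable)
  then show ?thesis unfolding zempty_def using elts_the_set[of "{}"] by simp
qed

lemma elts_upair [simp]: "elts (upair x y) = {x, y}"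
  unfolding upair_def using pairing[of x y]
  by (intro elts_the_set) (auto simp: elts_def)

lemma elts_zUnion [simp]: "elts (zUnion A) = (\<Union>x\<in>elts A. elts x)"
proof -
  obtain z where "\<forall>w. w \<^bold>\<in> z \<longleftrightarrow> (\<exists>y. y \<^bold>\<in> A \<and> w \<^bold>\<in> y)" using union[of A] by blast
  then have "elts z = (\<Union>x\<in>elts A. elts x)" by (auto simp: elts_def)
  then show ?thesis unfolding zUnion_def by (intro elts_the_set exI)
qed

lemma elts_zPow [simp]: "elts (zPow A) = {x. elts x \<subseteq> elts A}"
proof -
  obtain z where "\<forall>w. w \<^bold>\<in> z \<longleftrightarrow> (\<forall>v. v \<^bold>\<in> w \<longrightarrow> v \<^bold>\<in> A)" using power_set[of A] by blast
  then have "elts z = {x. elts x \<subseteq> elts A}" by (auto simp: elts_def)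
  then show ?thesis unfolding zPow_def by (intro elts_the_set exI)
qed

lemma elts_zDiff [simp]: "elts (zDiff x y) = elts x - elts y"
  unfolding zDiff_def set_diff_eq by (rule elts_the_set_sep[of _ x]) (intro definable | simp)+

lemma elts_zsucc [simp]: "elts (zsucc x) = insert x (elts x)"
  unfolding zsucc_def
  by (rule elts_the_set, rule exI[of _ "zUnion (upair x (upair x x))"]) auto

lemma opair_inject [simp]: "opair a b = opair c d \<longleftrightarrow> a = c \<and> b = d"
proof
  assume "opair a b = opair c d"
  moreover have "elts ` elts (opair x y) = {{x}, {x, y}}" for x y :: 'a
    by (simp add: opair_def)
  ultimately have "{{a}, {a, b}} = {{c}, {c, d}}" by metis
  then show "a = c \<and> b = d" by (auto simp: doubleton_eq_iff)
qed simp

lemma def_term_upair [definable]: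
  "def_term F \<Longrightarrow> def_term G \<Longrightarrow> def_term (\<lambda>s. upair (F s) (G s))"
proof (rule def_term_subst2[of upair])
  have "upair x y = the_set {w. w = x \<or> w = y}" for x y :: 'a
    unfolding upair_def by (rule arg_cong[of _ _ the_set]) auto
  then show "def_term (\<lambda>s::nat \<Rightarrow> 'a. upair (s 0) (s (Suc 0)))"
    by (simp only:) (intro definable)
qed

lemma def_term_opair [definable]:
  "def_term F \<Longrightarrow> def_term G \<Longrightarrow> def_term (\<lambda>s. opair (F s) (G s))"
  unfolding opair_def by (intro definable)

lemma elts_zTimes [simp]: "elts (zTimes A B) = {opair x y | x y. x \<in> elts A \<and> y \<in> elts B}"
  unfolding zTimes_def
proof (rule elts_the_set_sep)
  show "def_pred (\<lambda>s. \<exists>x y. s 0 = opair x y \<and> x \<in> elts A \<and> y \<in> elts B)"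
    by (intro definable)
  show "w \<in> elts (zPow (zPow (zUnion (upair A B))))"
    if "\<exists>x y. w = opair x y \<and> x \<in> elts A \<and> y \<in> elts B" for w
    using that by (auto simp: opair_def)
qed

lemma def_term_zTimes [definable]:
  "def_term F \<Longrightarrow> def_term G \<Longrightarrow> def_term (\<lambda>s. zTimes (F s) (G s))"
  by (rule def_term_subst2[of zTimes]) (unfold zTimes_def, intro definable)

lemma def_term_zDiff [definable]:
  "def_term F \<Longrightarrow> def_term G \<Longrightarrow> def_term (\<lambda>s. zDiff (F s) (G s))"
  by (rule def_term_subst2[of zDiff]) (unfold zDiff_def set_diff_eq, intro definable)

lemma def_term_zsucc [definable]: "def_term F \<Longrightarrow> def_term (\<lambda>s. zsucc (F s))"
  by (rule def_term_subst1[of zsucc]) (unfold zsucc_def insert_compr, intro definable)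

lemma def_pred_is_fun [definable]:
  "def_term F \<Longrightarrow> def_term A \<Longrightarrow> def_term B \<Longrightarrow> def_pred (\<lambda>s. is_fun (F s) (A s) (B s))"
  by (rule def_pred_subst3[of is_fun]) (unfold is_fun_def, intro definable)

lemma def_term_app [definable]:
  "def_term F \<Longrightarrow> def_term G \<Longrightarrow> def_term (\<lambda>s. app (F s) (G s))"
proof (rule def_term_subst2[of app])
  have *: "y = app f x \<longleftrightarrow> (if \<exists>!y. opair x y \<in> elts f then opair x y \<in> elts f else y = zempty)"
    for f x y :: 'a
    unfolding app_def by (auto intro: theI the1_equality[symmetric])
  show "def_term (\<lambda>s::nat \<Rightarrow> 'a. app (s 0) (s (Suc 0)))"
    unfolding def_term_def * if_bool_eq_conj by (intro definable)
qed

lemma foundation':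
  assumes "elts x \<noteq> {}" shows "\<exists>y\<in>elts x. elts x \<inter> elts y = {}"
proof -
  obtain y where "y \<^bold>\<in> x" "\<not> (\<exists>z. z \<^bold>\<in> x \<and> z \<^bold>\<in> y)"
    using foundation[of x] assms by (auto simp: elts_def)
  then show ?thesis by (auto simp: elts_def)
qed

lemma not_mem_self: "x \<notin> elts x"
  using foundation'[of "upair x x"] by auto

lemma mem_asym: "x \<in> elts y \<Longrightarrow> y \<notin> elts x"
  using foundation'[of "upair x y"] by auto

lemma zsucc_inject: "zsucc x = zsucc y \<longleftrightarrow> x = y"
  using elts_zsucc[of x] elts_zsucc[of y] mem_asym by (metis insert_iff)

lemma zsucc_neq_zempty: "zsucc x \<noteq> zempty"
  using elts_zsucc[of x] by (metis elts_zempty insert_not_empty)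

section \<open>The natural numbers of the model\<close>

lemma def_pred_is_inductive [definable]: "def_term F \<Longrightarrow> def_pred (\<lambda>s. is_inductive (F s))"
  by (rule def_pred_subst1[of is_inductive]) (unfold is_inductive_def, intro definable)

text \<open>The axiom of infinity provides one inductive set, from which separation cuts out the
  intersection of all of them.\<close>

lemma elts_zomega: "elts zomega = {n. \<forall>I. is_inductive I \<longrightarrow> n \<in> elts I}"
proof -
  obtain I e :: 'a where I: "e \<^bold>\<in> I" "\<forall>w. \<not> w \<^bold>\<in> e"
    "\<forall>x. x \<^bold>\<in> I \<longrightarrow> (\<exists>y. y \<^bold>\<in> I \<and> (\<forall>w. w \<^bold>\<in> y \<longleftrightarrow> w \<^bold>\<in> x \<or> w = x))"
    using infinity[where ?'a='a] by blast
  have "e = zempty" using I(2) elts_inject[of e zempty] by (simp add: elts_def[of e])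
  moreover have "zsucc x \<in> elts I" if "x \<in> elts I" for x
  proof -
    have "x \<^bold>\<in> I" using that by (simp add: elts_def)
    then obtain y where y: "y \<^bold>\<in> I" "\<forall>w. w \<^bold>\<in> y \<longleftrightarrow> w \<^bold>\<in> x \<or> w = x" using I(3) by blast
    then have "elts y = elts (zsucc x)" by (auto simp: elts_def[of y] elts_def[of x])
    then have "y = zsucc x" by (simp only: elts_inject)
    then show ?thesis using y(1) by (simp add: elts_def[of I])
  qed
  ultimately have "is_inductive I" using I(1) by (simp add: is_inductive_def elts_def[of I])
  then show ?thesis unfolding zomega_def
    by (intro elts_the_set_sep[of _ I] definable) blast
qed

lemma zempty_in_zomega [simp]: "zempty \<in> elts zomega"
  by (simp add: elts_zomega is_inductive_def)

lemma zsucc_in_zomega [simp]: "n \<in> elts zomega \<Longrightarrow> zsucc n \<in> elts zomega"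
  by (simp add: elts_zomega is_inductive_def)

text \<open>Only a set of the model can be inductive, and \<open>zomega\<close> may contain more
  than the standard numbers, so induction is available for definable \<open>P\<close> alone. Hence
  the \<open>def_pred\<close> case in each induction.\<close>

lemma zomega_induct [consumes 1, case_names def_pred zempty zsucc]:
  assumes n: "n \<in> elts zomega" and P: "def_pred (\<lambda>s. P (s 0))"
    and "P zempty" "\<And>n. n \<in> elts zomega \<Longrightarrow> P n \<Longrightarrow> P (zsucc n)"
  shows "P n"
proof -
  obtain z where z: "elts z = {w \<in> elts zomega. P w}" using separation'[OF P] by blast
  then have "is_inductive z" unfolding is_inductive_def using assms(3,4) by simp
  then show ?thesis using n z unfolding elts_zomega by blast
qed

lemma zomega_elts: "n \<in> elts zomega \<Longrightarrow> elts n \<subseteq> elts zomega"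
  by (induction rule: zomega_induct) ((intro definable)?; auto)+

lemma zomega_transitive:
  assumes "n \<in> elts zomega" "m \<in> elts n" shows "elts m \<subseteq> elts n"
proof -
  have "\<forall>m\<in>elts n. elts m \<subseteq> elts n" using assms(1)
    by (induction rule: zomega_induct) ((intro definable)?; auto)+
  then show ?thesis using assms(2) by blast
qed

lemma zempty_le: "n \<in> elts zomega \<Longrightarrow> zempty = n \<or> zempty \<in> elts n"
  by (induction rule: zomega_induct) ((intro definable)?; auto)+

lemma zsucc_le: "m \<in> elts zomega \<Longrightarrow> n \<in> elts m \<longrightarrow> zsucc n = m \<or> zsucc n \<in> elts m"
  by (induction rule: zomega_induct) ((intro definable)?; auto)+

lemma zomega_trichotomy:
  assumes "n \<in> elts zomega" "m \<in> elts zomega"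
  shows "n \<in> elts m \<or> n = m \<or> m \<in> elts n"
proof -
  have "\<forall>m\<in>elts zomega. n \<in> elts m \<or> n = m \<or> m \<in> elts n" using assms(1)
  proof (induction rule: zomega_induct)
    case def_pred
    show ?case by (intro definable)
  next
    case zempty
    show ?case using zempty_le by blast
  next
    case (zsucc n)
    then show ?case using zsucc_le by auto
  qed
  then show ?thesis using assms(2) by blast
qed

lemma zomega_le_iff:
  assumes "n \<in> elts zomega" "m \<in> elts zomega"
  shows "elts n \<subseteq> elts m \<longleftrightarrow> n \<in> elts m \<or> n = m"
  using zomega_trichotomy[OF assms] zomega_transitive[OF assms(2)] not_mem_self by blast

lemma zomega_linear:
  assumes "n \<in> elts zomega" "m \<in> elts zomega"
  shows "elts n \<subseteq> elts m \<or> elts m \<subseteq> elts n"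
  using zomega_trichotomy[OF assms] zomega_le_iff assms by blast

lemma zomega_le_zsucc:
  assumes "n \<in> elts zomega" "m \<in> elts zomega" "elts m \<subseteq> elts (zsucc n)"
  shows "m = zsucc n \<or> elts m \<subseteq> elts n"
  using assms zomega_le_iff[of m "zsucc n"] zomega_le_iff[of m n] by auto

text \<open>Foundation gives a membership-minimal element of the set cut out by \<open>P\<close>;
  trichotomy makes it the least one.\<close>

lemma zomega_least:
  assumes "def_pred (\<lambda>s. P (s 0))" "n \<in> elts zomega" "P n"
  shows "\<exists>n\<in>elts zomega. P n \<and> (\<forall>m\<in>elts zomega. P m \<longrightarrow> elts n \<subseteq> elts m)"
proof -
  obtain z where z: "elts z = {w \<in> elts zomega. P w}" using separation'[OF assms(1)] by blast
  then have "n \<in> elts z" using assms by blast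
  then obtain y where y: "y \<in> elts z" "\<And>w. w \<in> elts z \<Longrightarrow> w \<notin> elts y"
    using foundation[of z] unfolding elts_def by blast
  then have "elts y \<subseteq> elts m" if "m \<in> elts z" for m
    using zomega_trichotomy[of y m] zomega_le_iff[of y m] z that by blast
  then show ?thesis using y(1) z by blast
qed

section \<open>Functions and recursion\<close>

lemma is_fun_app:
  assumes "is_fun f A B" "x \<in> elts A"
  shows "app f x \<in> elts B" "opair x y \<in> elts f \<longleftrightarrow> y = app f x"
proof -
  have ex: "\<exists>!y. opair x y \<in> elts f" using assms unfolding is_fun_def by blast
  then have *: "opair x (app f x) \<in> elts f" unfolding app_def using theI'[OF ex] by simp
  then show "opair x y \<in> elts f \<longleftrightarrow> y = app f x" using ex by blast
  show "app f x \<in> elts B" using * assms(1) unfolding is_fun_def by auto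
qed

lemma is_fun_elts:
  assumes "is_fun f A B" shows "elts f = {opair x (app f x) | x. x \<in> elts A}"
proof -
  have "p \<in> elts f \<longleftrightarrow> (\<exists>x. p = opair x (app f x) \<and> x \<in> elts A)" for p
  proof
    assume p: "p \<in> elts f"
    then obtain x y where "p = opair x y" "x \<in> elts A" using assms unfolding is_fun_def by auto
    then show "\<exists>x. p = opair x (app f x) \<and> x \<in> elts A" using is_fun_app(2)[OF assms] p by metis
  qed (use is_fun_app(2)[OF assms] in blast)
  then show ?thesis by blast
qed

lemma is_fun_ext:
  assumes "is_fun f A B" "is_fun g A C" "\<And>x. x \<in> elts A \<Longrightarrow> app f x = app g x"
  shows "f = g"
proof -
  have "elts f = elts g" unfolding is_fun_elts[OF assms(1)] is_fun_elts[OF assms(2)]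
    using assms(3) by auto
  then show ?thesis by (simp add: elts_inject)
qed

text \<open>Cut down to \<open>zTimes A B\<close>, the relation is already the graph; uniqueness of
  the value stands in for choice.\<close>

lemma ex_fun_rel:
  assumes P: "def_pred (\<lambda>s. P (s 0) (s (Suc 0)))"
    and ex: "\<And>x. x \<in> elts A \<Longrightarrow> \<exists>y\<in>elts B. P x y"
    and uniq: "\<And>x y z. x \<in> elts A \<Longrightarrow> P x y \<Longrightarrow> P x z \<Longrightarrow> y = z"
  shows "\<exists>f. is_fun f A B \<and> (\<forall>x\<in>elts A. P x (app f x))"
proof -
  have "def_pred (\<lambda>s. P (s (Suc 0)) (s 0))"
    by (rule def_pred_subst2[OF P]) (intro definable)+
  then have "\<exists>f. elts f = {p \<in> elts (zTimes A B). \<exists>x y. p = opair x y \<and> P x y}"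
    by (intro separation' definable)
  then obtain f where "elts f = {p \<in> elts (zTimes A B). \<exists>x y. p = opair x y \<and> P x y}"
    by blast
  then have f: "elts f = {opair x y | x y. x \<in> elts A \<and> y \<in> elts B \<and> P x y}"
    by auto
  have "is_fun f A B" unfolding is_fun_def
  proof
    show "elts f \<subseteq> elts (zTimes A B)" using f by auto
    show "\<forall>x\<in>elts A. \<exists>!y. opair x y \<in> elts f"
      using f ex uniq by simp metis
  qed
  moreover have "P x (app f x)" if "x \<in> elts A" for x
    using is_fun_app(2)[OF \<open>is_fun f A B\<close> that, of "app f x"] f by simp
  ultimately show ?thesis by blast
qed

lemma ex_fun:
  assumes G: "def_term (\<lambda>s. G (s 0))" and "\<And>x. x \<in> elts A \<Longrightarrow> G x \<in> elts B"
  shows "\<exists>f. is_fun f A B \<and> (\<forall>x\<in>elts A. app f x = G x)"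
proof (rule ex_fun_rel)
  have "def_term (\<lambda>s. G (s (Suc 0)))" using def_term_rename[OF G, of Suc] by simp
  then show "def_pred (\<lambda>s. s (Suc 0) = G (s 0))" by (intro definable G)
qed (use assms in auto)

text \<open>The recursively defined function is the least set of pairs that is closed under the
  recursion step.\<close>

lemma ex_recursive_fun:
  assumes G: "def_term (\<lambda>s. G (s 0) (s (Suc 0)))" and a: "a \<in> elts Q"
    and GQ: "\<And>n q. n \<in> elts zomega \<Longrightarrow> q \<in> elts Q \<Longrightarrow> G n q \<in> elts Q"
  shows "\<exists>f. is_fun f zomega Q \<and> app f zempty = a \<and>
    (\<forall>n\<in>elts zomega. app f (zsucc n) = G n (app f n))"
proof -
  define closed where "closed Z \<longleftrightarrow> opair zempty a \<in> elts Z \<and>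
    (\<forall>n\<in>elts zomega. \<forall>q\<in>elts Q. opair n q \<in> elts Z \<longrightarrow> opair (zsucc n) (G n q) \<in> elts Z)" for Z
  have G': "def_term (\<lambda>s. G (s i) (s j))" for i j
    by (rule def_term_subst2[OF G]) (intro definable)+
  have "\<exists>f. elts f = {p \<in> elts (zTimes zomega Q). \<forall>Z. closed Z \<longrightarrow> p \<in> elts Z}"
    unfolding closed_def by (intro separation' definable G')
  then obtain f where f: "elts f = {p \<in> elts (zTimes zomega Q). \<forall>Z. closed Z \<longrightarrow> p \<in> elts Z}"
    by blast
  have sub: "elts f \<subseteq> elts (zTimes zomega Q)" using f by blast
  have f0: "opair zempty a \<in> elts f" using f a unfolding closed_def by simp
  have fS: "opair (zsucc n) (G n q) \<in> elts f" if "n \<in> elts zomega" "opair n q \<in> elts f" for n q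
    using that f GQ unfolding closed_def by auto
  have least: "elts f \<subseteq> elts Z" if "closed Z" for Z using f that by blast
  \<comment> \<open>A second value at some argument could be deleted without losing closedness,
    against the minimality of \<open>f\<close>; the two uniqueness claims below use this.\<close>
  have remove: "\<exists>Z. elts Z = elts f - {p}" for p
    by (rule exI[of _ "zDiff f (upair p p)"]) simp
  have u0: "q = a" if q: "opair zempty q \<in> elts f" for q
  proof (rule ccontr)
    assume "q \<noteq> a"
    obtain Z where Z: "elts Z = elts f - {opair zempty q}" using remove by blast
    have "closed Z" unfolding closed_def Z using f0 fS \<open>q \<noteq> a\<close>
      by (auto simp: zsucc_neq_zempty)
    then show False using least q Z by blast
  qed
  have uS: "r = G n q" if n: "n \<in> elts zomega" and uq: "\<And>q'. opair n q' \<in> elts f \<Longrightarrow> q' = q"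
    and r: "opair (zsucc n) r \<in> elts f" for n q r
  proof (rule ccontr)
    assume "r \<noteq> G n q"
    obtain Z where Z: "elts Z = elts f - {opair (zsucc n) r}" using remove by blast
    have "closed Z" unfolding closed_def Z using f0 fS uq \<open>r \<noteq> G n q\<close>
      by (auto simp: zsucc_inject zsucc_neq_zempty[symmetric])
    then show False using least r Z by blast
  qed
  have "\<exists>!q. opair n q \<in> elts f" if "n \<in> elts zomega" for n
    using that
  proof (induction rule: zomega_induct)
    case def_pred
    show ?case by (intro definable)
  next
    case zempty
    show ?case using f0 u0 by blast
  next
    case (zsucc n)
    then obtain q where "opair n q \<in> elts f" "\<And>q'. opair n q' \<in> elts f \<Longrightarrow> q' = q" by blast
    then show ?case using fS uS zsucc(1) by blast
  qed
  then have f_fun: "is_fun f zomega Q" using sub unfolding is_fun_def by blast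
  have "app f zempty = a" using is_fun_app(2)[OF f_fun] f0 by simp
  moreover have "app f (zsucc n) = G n (app f n)" if "n \<in> elts zomega" for n
    using is_fun_app(2)[OF f_fun] fS that by simp
  ultimately show ?thesis using f_fun by blast
qed

lemma recursive_fun_unique:
  assumes f: "is_fun f zomega Q" "\<forall>n\<in>elts zomega. app f (zsucc n) = G n (app f n)"
    and g: "is_fun g zomega Q" "\<forall>n\<in>elts zomega. app g (zsucc n) = G n (app g n)"
    and "app f zempty = app g zempty"
  shows "f = g"
proof (rule is_fun_ext[OF f(1) g(1)])
  fix n assume "n \<in> elts (zomega :: 'a)"
  then show "app f n = app g n"
    by (induction rule: zomega_induct) ((intro definable)?; use f g assms(5) in simp)+
qed

lemma ex_choice_function:
  assumes P: "def_pred (\<lambda>s. P (s 0) (s (Suc 0)))"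
    and ex: "\<And>F. F \<in> elts A \<Longrightarrow> \<exists>x\<in>elts F. P F x"
    and uniq: "\<And>F x y. F \<in> elts A \<Longrightarrow> P F x \<Longrightarrow> P F y \<Longrightarrow> x = y"
  shows "\<exists>c. is_choice_function c A"
proof -
  have "\<exists>y\<in>elts (zUnion A). P F y" if "F \<in> elts A" for F
    using ex[OF that] that by auto
  then obtain c where "is_fun c A (zUnion A)" "\<forall>x\<in>elts A. P x (app c x)"
    using ex_fun_rel[OF P, of A "zUnion A"] uniq by blast
  \<comment> \<open>A value of \<open>c\<close> is so far known to lie only in the union of
    \<open>A\<close>; uniqueness identifies it with the witness inside the given member.\<close>
  then show ?thesis unfolding is_choice_function_def using ex uniq by metis
qed

text \<open>Written as the set of elements of the component, so that \<open>def_term_the_set\<close>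
  applies; the value is \<open>zempty\<close> if \<open>p\<close> is not a pair.\<close>

definition zfst :: "'a::zf \<Rightarrow> 'a" where
  "zfst p = the_set {w. \<exists>x y. p = opair x y \<and> w \<in> elts x}"

definition zsnd :: "'a::zf \<Rightarrow> 'a" where
  "zsnd p = the_set {w. \<exists>x y. p = opair x y \<and> w \<in> elts y}"

lemma zfst_opair [simp]: "zfst (opair x y) = x"
  unfolding zfst_def by simp

lemma zsnd_opair [simp]: "zsnd (opair x y) = y"
  unfolding zsnd_def by simp

lemma def_term_zfst [definable]: "def_term F \<Longrightarrow> def_term (\<lambda>s. zfst (F s))"
  by (rule def_term_subst1[of zfst]) (unfold zfst_def, intro definable)

lemma def_term_zsnd [definable]: "def_term F \<Longrightarrow> def_term (\<lambda>s. zsnd (F s))"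
  by (rule def_term_subst1[of zsnd]) (unfold zsnd_def, intro definable)

text \<open>An enumeration of all pairs \<open>(n, N)\<close> with \<open>n \<le> N\<close>, stepping from \<open>(n, N)\<close> to
  \<open>(n + 1, N)\<close> if \<open>n < N\<close> and to \<open>(0, N + 1)\<close> otherwise.\<close>

lemma ex_pair_enumeration:
  "\<exists>w::'a::zf. is_fun w zomega (zTimes zomega zomega) \<and>
    (\<forall>N\<in>elts zomega. \<forall>n\<in>elts (zsucc N). \<exists>j\<in>elts zomega. app w j = opair n N)"
proof -
  define step :: "'a \<Rightarrow> 'a" where "step p = (if zfst p \<in> elts (zsnd p)
    then opair (zsucc (zfst p)) (zsnd p) else opair zempty (zsucc (zsnd p)))" for p
  have "\<exists>w. is_fun w zomega (zTimes zomega zomega) \<and> app w zempty = opair zempty zempty \<and>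
    (\<forall>n\<in>elts zomega. app w (zsucc n) = step (app w n))"
  proof (rule ex_recursive_fun)
    show "def_term (\<lambda>s. step (s (Suc 0)))" unfolding step_def by (intro definable)
  qed (auto simp: step_def)
  then obtain w where w: "is_fun w zomega (zTimes zomega zomega)"
    "app w zempty = opair zempty zempty"
    "\<And>n. n \<in> elts zomega \<Longrightarrow> app w (zsucc n) = step (app w n)" by blast
  \<comment> \<open>The beginning of row \<open>N\<close> is a premise because the induction in
    \<open>start\<close> itself uses \<open>row\<close> to reach the end \<open>(N, N)\<close> of a
    row, from which the next row begins.\<close>
  have row: "\<exists>j\<in>elts zomega. app w j = opair n N"
    if "n \<in> elts zomega" "n \<in> elts (zsucc N)" "N \<in> elts zomega"
      "\<exists>j\<in>elts zomega. app w j = opair zempty N" for n N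
  proof -
    have "n \<in> elts (zsucc N) \<longrightarrow> (\<exists>j\<in>elts zomega. app w j = opair n N)" using that(1)
    proof (induction rule: zomega_induct)
      case def_pred
      show ?case by (intro definable)
    next
      case zempty
      show ?case using that(4) by blast
    next
      case (zsucc n)
      show ?case
      proof
        assume "zsucc n \<in> elts (zsucc N)"
        then have n: "n \<in> elts N"
          using zomega_transitive[OF that(3), of "zsucc n"] by auto
        then obtain j where "j \<in> elts zomega" "app w j = opair n N" using zsucc by auto
        then have "app w (zsucc j) = opair (zsucc n) N" using w(3) n by (simp add: step_def)
        then show "\<exists>j\<in>elts zomega. app w j = opair (zsucc n) N"
          using \<open>j \<in> elts zomega\<close> zsucc_in_zomega by blast
      qed
    qed
    then show ?thesis using that(2) by blast
  qed
  have start: "\<exists>j\<in>elts zomega. app w j = opair zempty N" if "N \<in> elts zomega" for N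
    using that
  proof (induction rule: zomega_induct)
    case def_pred
    show ?case by (intro definable)
  next
    case zempty
    show ?case using w(2) zempty_in_zomega by blast
  next
    case (zsucc N)
    then obtain j where "j \<in> elts zomega" "app w j = opair N N" using row by auto
    then have "app w (zsucc j) = opair zempty (zsucc N)"
      using w(3) by (simp add: step_def not_mem_self)
    then show ?case using \<open>j \<in> elts zomega\<close> zsucc_in_zomega by blast
  qed
  have "n \<in> elts zomega" if "n \<in> elts (zsucc N)" "N \<in> elts zomega" for n N :: 'a
    using that zomega_elts by auto
  then show ?thesis using w(1) row start by blast
qed

section \<open>The real numbers of the model\<close>

locale reals =
  fixes R :: "'a::zf ofield"
  assumes reals: "is_reals R"
begin

abbreviation add (infixl \<open>\<oplus>\<close> 65) where "x \<oplus> y \<equiv> app2 (radd R) x y"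
abbreviation mult (infixl \<open>\<otimes>\<close> 70) where "x \<otimes> y \<equiv> app2 (rmul R) x y"
abbreviation less_eq (infix \<open>\<preceq>\<close> 50) where "x \<preceq> y \<equiv> rle R x y"
abbreviation less (infix \<open>\<prec>\<close> 50) where "x \<prec> y \<equiv> rless R x y"
abbreviation zero (\<open>\<zero>\<close>) where "\<zero> \<equiv> rzero R"
abbreviation K where "K \<equiv> elts (rcar R)"

lemma
  shows add_fun: "is_fun (radd R) (zTimes (rcar R) (rcar R)) (rcar R)"
    and mult_fun: "is_fun (rmul R) (zTimes (rcar R) (rcar R)) (rcar R)"
    and zero_in [simp]: "\<zero> \<in> K"
    and one_in [simp]: "rone R \<in> K"
    and zero_neq_one: "\<zero> \<noteq> rone R"
    and add_assoc [rule_format]: "\<forall>x\<in>K. \<forall>y\<in>K. \<forall>z\<in>K. x \<oplus> y \<oplus> z = x \<oplus> (y \<oplus> z)"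
    and add_commute [rule_format]: "\<forall>x\<in>K. \<forall>y\<in>K. x \<oplus> y = y \<oplus> x"
    and zero_add [rule_format, simp]: "\<forall>x\<in>K. \<zero> \<oplus> x = x"
    and minus_ex [rule_format]: "\<forall>x\<in>K. \<exists>y\<in>K. x \<oplus> y = \<zero>"
    and mult_commute [rule_format]: "\<forall>x\<in>K. \<forall>y\<in>K. x \<otimes> y = y \<otimes> x"
    and one_mult [rule_format]: "\<forall>x\<in>K. rone R \<otimes> x = x"
    and inverse_ex [rule_format]: "\<forall>x\<in>K. x \<noteq> \<zero> \<longrightarrow> (\<exists>y\<in>K. x \<otimes> y = rone R)"
    and distrib [rule_format]: "\<forall>x\<in>K. \<forall>y\<in>K. \<forall>z\<in>K. x \<otimes> (y \<oplus> z) = x \<otimes> y \<oplus> x \<otimes> z"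
    and le_total [rule_format]: "\<forall>x\<in>K. \<forall>y\<in>K. x \<preceq> y \<or> y \<preceq> x"
    and le_antisym' [rule_format]: "\<forall>x\<in>K. \<forall>y\<in>K. x \<preceq> y \<and> y \<preceq> x \<longrightarrow> x = y"
    and le_trans' [rule_format]: "\<forall>x\<in>K. \<forall>y\<in>K. \<forall>z\<in>K. x \<preceq> y \<and> y \<preceq> z \<longrightarrow> x \<preceq> z"
    and add_right_mono [rule_format]: "\<forall>x\<in>K. \<forall>y\<in>K. \<forall>z\<in>K. x \<preceq> y \<longrightarrow> x \<oplus> z \<preceq> y \<oplus> z"
  using reals unfolding is_reals_def is_ordered_field_def Let_def
  by - (elim conjE; assumption)+

lemma le_antisym: "x \<in> K \<Longrightarrow> y \<in> K \<Longrightarrow> x \<preceq> y \<Longrightarrow> y \<preceq> x \<Longrightarrow> x = y"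
  and le_trans: "x \<in> K \<Longrightarrow> y \<in> K \<Longrightarrow> z \<in> K \<Longrightarrow> x \<preceq> y \<Longrightarrow> y \<preceq> z \<Longrightarrow> x \<preceq> z"
  by (simp_all add: le_antisym' le_trans'[of x y z])

lemma add_in [simp]: "x \<in> K \<Longrightarrow> y \<in> K \<Longrightarrow> x \<oplus> y \<in> K"
  by (rule is_fun_app(1)[OF add_fun]) simp

lemma mult_in [simp]: "x \<in> K \<Longrightarrow> y \<in> K \<Longrightarrow> x \<otimes> y \<in> K"
  by (rule is_fun_app(1)[OF mult_fun]) simp

lemma le_refl [simp]: "x \<in> K \<Longrightarrow> x \<preceq> x"
  using le_total by blast

lemma not_le: "x \<in> K \<Longrightarrow> y \<in> K \<Longrightarrow> \<not> x \<preceq> y \<longleftrightarrow> y \<prec> x"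
  using le_total[of x y] le_antisym[of x y] le_refl by auto

lemma less_le_trans: "x \<in> K \<Longrightarrow> y \<in> K \<Longrightarrow> z \<in> K \<Longrightarrow> x \<prec> y \<Longrightarrow> y \<preceq> z \<Longrightarrow> x \<prec> z"
  and le_less_trans: "x \<in> K \<Longrightarrow> y \<in> K \<Longrightarrow> z \<in> K \<Longrightarrow> x \<preceq> y \<Longrightarrow> y \<prec> z \<Longrightarrow> x \<prec> z"
  using le_trans[of x y z] le_antisym[of x y] le_antisym[of y z] by auto

lemma add_right_cancel:
  assumes "x \<in> K" "y \<in> K" "z \<in> K" "x \<oplus> z = y \<oplus> z" shows "x = y"
proof -
  obtain w where w: "w \<in> K" "z \<oplus> w = \<zero>" using minus_ex assms(3) by blast
  have "x \<oplus> z \<oplus> w = x" "y \<oplus> z \<oplus> w = y"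
    using add_assoc[of x z w] add_assoc[of y z w] w assms(1-3)
      add_commute[of x \<zero>] add_commute[of y \<zero>] by simp_all
  then show ?thesis using assms(4) by metis
qed

lemma add_right_strict_mono:
  "x \<in> K \<Longrightarrow> y \<in> K \<Longrightarrow> z \<in> K \<Longrightarrow> x \<prec> y \<Longrightarrow> x \<oplus> z \<prec> y \<oplus> z"
  using add_right_mono add_right_cancel by blast

lemma add_left_mono: "x \<in> K \<Longrightarrow> y \<in> K \<Longrightarrow> z \<in> K \<Longrightarrow> x \<preceq> y \<Longrightarrow> z \<oplus> x \<preceq> z \<oplus> y"
  using add_right_mono[of x y z] add_commute[of _ z] by simp

lemma add_strict_mono:
  assumes "x \<in> K" "y \<in> K" "z \<in> K" "w \<in> K" "x \<prec> y" "z \<prec> w"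
  shows "x \<oplus> z \<prec> y \<oplus> w"
  using less_le_trans[OF _ _ _ add_right_strict_mono[of x y z] add_left_mono[of z w y]] assms
  by simp

text \<open>If 1 + 1 were 0, adding 1 to both sides would turn either of the inequalities between 0
  and 1 into the other, so both would hold.\<close>

lemma one_add_one_neq_zero: "rone R \<oplus> rone R \<noteq> \<zero>"
proof
  assume eq: "rone R \<oplus> rone R = \<zero>"
  show False
  proof (cases "\<zero> \<preceq> rone R")
    case True
    then have "rone R \<preceq> \<zero>" using add_right_mono[of \<zero> "rone R" "rone R"] one_in eq by simp
    then show False using True le_antisym[of \<zero> "rone R"] zero_neq_one by simp
  next
    case False
    then have "rone R \<preceq> \<zero>" using le_total one_in zero_in by blast
    then have "\<zero> \<preceq> rone R" using add_right_mono[of "rone R" \<zero> "rone R"] one_in eq by simp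
    then show False using False by blast
  qed
qed

text \<open>One multiplier \<open>u\<close> serves all \<open>x\<close>, so halving is a definable
  map and can be iterated by recursion.\<close>

lemma ex_half: "\<exists>u\<in>K. \<forall>x\<in>K. x \<otimes> u \<in> K \<and> x \<otimes> u \<oplus> x \<otimes> u = x"
proof -
  obtain u where u: "u \<in> K" "(rone R \<oplus> rone R) \<otimes> u = rone R"
    using inverse_ex[OF _ one_add_one_neq_zero] one_in by auto
  have "u \<otimes> rone R = u" using one_mult[OF u(1)] mult_commute[OF u(1) one_in] by simp
  then have uu: "u \<oplus> u = rone R"
    using u distrib[of u "rone R" "rone R"] one_in mult_commute[of u "rone R \<oplus> rone R"] by simp
  have "x \<otimes> u \<oplus> x \<otimes> u = x" if "x \<in> K" for x
    using distrib[OF that u(1) u(1)] uu one_mult[OF that] mult_commute[OF that one_in] by simp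
  then show ?thesis using u(1) mult_in by blast
qed

lemma half_pos:
  assumes "y \<in> K" "\<zero> \<prec> y \<oplus> y" shows "\<zero> \<prec> y" "y \<prec> y \<oplus> y"
proof -
  show *: "\<zero> \<prec> y"
  proof (rule ccontr)
    assume "\<not> \<zero> \<prec> y"
    then have "y \<preceq> \<zero>" using not_le[of y \<zero>] assms(1) by auto
    then have "y \<oplus> y \<preceq> \<zero>"
      using le_trans[OF _ _ _ add_right_mono[of y \<zero> y]] assms(1) by simp
    then show False using not_le[of "y \<oplus> y" \<zero>] assms by auto
  qed
  show "y \<prec> y \<oplus> y" using add_right_strict_mono[of \<zero> y y] * assms(1) by simp
qed

text \<open>\<open>y\<close> is a quarter of \<open>x\<close>. A sum of three equal terms is the
  bound that passing to closures produces in \<open>shadow_small\<close>.\<close>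

lemma ex_third:
  assumes "x \<in> K" "\<zero> \<prec> x" shows "\<exists>y\<in>K. \<zero> \<prec> y \<and> y \<oplus> (y \<oplus> y) \<prec> x"
proof -
  obtain z where z: "z \<in> K" "z \<oplus> z = x" using ex_half assms(1) by blast
  then have "\<zero> \<prec> z" using half_pos assms(2) by blast
  obtain y where y: "y \<in> K" "y \<oplus> y = z" using ex_half z(1) by blast
  then have "\<zero> \<prec> y" "y \<prec> z" using half_pos[of y] y \<open>\<zero> \<prec> z\<close> by simp_all
  moreover have "y \<oplus> (y \<oplus> y) \<prec> x"
    using add_right_strict_mono[OF _ _ _ \<open>y \<prec> z\<close>, of z] y z by simp
  ultimately show ?thesis using y(1) by blast
qed

lemma ex_pos: "\<exists>x\<in>K. \<zero> \<prec> x"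
proof (cases "\<zero> \<preceq> rone R")
  case True
  then show ?thesis using one_in zero_neq_one by blast
next
  case False
  obtain y where y: "y \<in> K" "rone R \<oplus> y = \<zero>" using minus_ex one_in by blast
  have "rone R \<prec> \<zero>" using False not_le one_in zero_in by blast
  then have "\<zero> \<prec> y" using add_right_strict_mono[of "rone R" \<zero> y] y one_in by simp
  then show ?thesis using y(1) by blast
qed

text \<open>Positivity of the limit would contradict that halving maps the sequence into itself: the
  supremum of the lower bounds is \<open>0\<close>, as its double is a lower bound as well.\<close>

lemma ex_null_sequence:
  "\<exists>h. is_fun h zomega (rcar R) \<and>
    (\<forall>n\<in>elts zomega. \<zero> \<prec> app h n \<and> app h (zsucc n) \<prec> app h n) \<and>
    (\<forall>x\<in>K. \<zero> \<prec> x \<longrightarrow> (\<exists>n\<in>elts zomega. app h n \<prec> x))"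
proof -
  obtain u where u: "u \<in> K" "\<And>x. x \<in> K \<Longrightarrow> x \<otimes> u \<in> K"
      "\<And>x. x \<in> K \<Longrightarrow> x \<otimes> u \<oplus> x \<otimes> u = x" using ex_half by blast
  obtain a where a: "a \<in> K" "\<zero> \<prec> a" using ex_pos by blast
  have "\<exists>h. is_fun h zomega (rcar R) \<and> app h zempty = a \<and>
    (\<forall>n\<in>elts zomega. app h (zsucc n) = app h n \<otimes> u)"
    by (rule ex_recursive_fun[where G = "\<lambda>n x. x \<otimes> u"]) (use u a in \<open>simp_all add: definable\<close>)
  then obtain h where h: "is_fun h zomega (rcar R)" "app h zempty = a"
      "\<And>n. n \<in> elts zomega \<Longrightarrow> app h (zsucc n) = app h n \<otimes> u" by blast
  have hK: "app h n \<in> K" if "n \<in> elts zomega" for n using is_fun_app(1)[OF h(1) that] .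
  have double: "app h (zsucc n) \<oplus> app h (zsucc n) = app h n" if "n \<in> elts zomega" for n
    using h(3)[OF that] u(3) hK[OF that] by simp
  have pos: "\<zero> \<prec> app h n" if "n \<in> elts zomega" for n
    using that
  proof (induction rule: zomega_induct)
    case def_pred
    show ?case by (intro definable)
  next
    case zempty
    then show ?case using h(2) a by simp
  next
    case (zsucc n)
    then show ?case using half_pos(1)[of "app h (zsucc n)"] double[of n] hK[of "zsucc n"] by simp
  qed
  have decr: "app h (zsucc n) \<prec> app h n" if "n \<in> elts zomega" for n
    using half_pos(2)[of "app h (zsucc n)"] double[OF that] pos[OF that] hK[of "zsucc n"] that by simp
  have "\<exists>n\<in>elts zomega. app h n \<prec> x" if x: "x \<in> K" "\<zero> \<prec> x" for x
  proof -
    have "\<exists>S. elts S = {y \<in> K. \<forall>n\<in>elts zomega. y \<preceq> app h n}" by (intro separation' definable)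
    then obtain S where S: "elts S = {y \<in> K. \<forall>n\<in>elts zomega. y \<preceq> app h n}" by blast
    have "\<zero> \<in> elts S" using S pos by simp
    moreover have "\<forall>y\<in>elts S. y \<preceq> app h zempty" using S by simp
    ultimately have "\<exists>r. is_lub R (elts S) r"
      using reals S hK[of zempty] zempty_in_zomega unfolding is_reals_def by blast
    then obtain r where r: "r \<in> K" "\<And>y. y \<in> elts S \<Longrightarrow> y \<preceq> r"
        "\<And>u. u \<in> K \<Longrightarrow> \<forall>y\<in>elts S. y \<preceq> u \<Longrightarrow> r \<preceq> u"
      unfolding is_lub_def by blast
    have rh: "r \<preceq> app h n" if "n \<in> elts zomega" for n
      using r(3)[of "app h n"] hK[OF that] S that by simp
    have "r \<oplus> r \<preceq> app h n" if "n \<in> elts zomega" for n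
    proof -
      have *: "r \<preceq> app h (zsucc n)" "app h (zsucc n) \<in> K" using rh hK that by simp_all
      have "r \<oplus> r \<preceq> app h (zsucc n) \<oplus> app h (zsucc n)"
        using le_trans[OF _ _ _ add_right_mono[OF r(1) *(2) r(1) *(1)]
          add_left_mono[OF r(1) *(2) *(2) *(1)]] r(1) *(2) by simp
      then show ?thesis using double that by simp
    qed
    then have "r \<oplus> r \<in> elts S" using S r(1) by simp
    then have "r \<oplus> r \<preceq> r" using r(2) by blast
    then have "\<not> \<zero> \<prec> r"
      using add_right_strict_mono[of \<zero> r r] le_antisym[of "r \<oplus> r" r] r(1) by force
    then have "\<not> x \<preceq> r" using less_le_trans[OF _ _ _ x(2), of r] x(1) r(1) by auto
    then have "x \<notin> elts S" using r(2) by blast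
    then show ?thesis using S x(1) not_le[OF x(1)] hK by auto
  qed
  then show ?thesis using h(1) pos decr by blast
qed

text \<open>From the enumeration of pairs, \<open>e\<close> takes the first component and
  \<open>h\<close> the null sequence at the second. Each \<open>n\<close> is paired with every
  \<open>N\<close> from \<open>n\<close> on, hence with arbitrarily small precisions.\<close>

lemma ex_schedule:
  "\<exists>e h. is_fun e zomega zomega \<and> is_fun h zomega (rcar R) \<and>
    (\<forall>j\<in>elts zomega. \<zero> \<prec> app h j) \<and>
    (\<forall>n\<in>elts zomega. \<forall>x\<in>K. \<zero> \<prec> x \<longrightarrow> (\<exists>j\<in>elts zomega. app e j = n \<and> app h j \<prec> x))"
proof -
  obtain g where g: "is_fun g zomega (rcar R)"
      "\<And>n. n \<in> elts zomega \<Longrightarrow> \<zero> \<prec> app g n"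
      "\<And>n. n \<in> elts zomega \<Longrightarrow> app g (zsucc n) \<prec> app g n"
      "\<And>x. x \<in> K \<Longrightarrow> \<zero> \<prec> x \<Longrightarrow> \<exists>n\<in>elts zomega. app g n \<prec> x"
    using ex_null_sequence by blast
  obtain w :: 'a where w: "is_fun w zomega (zTimes zomega zomega)"
      "\<And>n N. N \<in> elts zomega \<Longrightarrow> n \<in> elts (zsucc N) \<Longrightarrow> \<exists>j\<in>elts zomega. app w j = opair n N"
    using ex_pair_enumeration by blast
  have wj: "\<exists>n N. app w j = opair n N \<and> n \<in> elts zomega \<and> N \<in> elts zomega"
    if "j \<in> elts zomega" for j using is_fun_app(1)[OF w(1) that] by auto
  have "\<exists>e. is_fun e zomega zomega \<and> (\<forall>j\<in>elts zomega. app e j = zfst (app w j))"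
    by (rule ex_fun) (intro definable, use wj in fastforce)
  then obtain e where e: "is_fun e zomega zomega" "\<And>j. j \<in> elts zomega \<Longrightarrow> app e j = zfst (app w j)"
    by blast
  have "\<exists>h. is_fun h zomega (rcar R) \<and> (\<forall>j\<in>elts zomega. app h j = app g (zsnd (app w j)))"
    by (rule ex_fun) (intro definable, use wj is_fun_app(1)[OF g(1)] in fastforce)
  then obtain h where h: "is_fun h zomega (rcar R)"
      "\<And>j. j \<in> elts zomega \<Longrightarrow> app h j = app g (zsnd (app w j))" by blast
  have "\<zero> \<prec> app h j" if "j \<in> elts zomega" for j
    using h(2)[OF that] wj[OF that] g(2) by fastforce
  moreover have "\<exists>j\<in>elts zomega. app e j = n \<and> app h j \<prec> x"
    if n: "n \<in> elts zomega" and x: "x \<in> K" "\<zero> \<prec> x" for n x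
  proof -
    \<comment> \<open>Only pairs with \<open>n\<close> at most \<open>N\<close> are enumerated, so
      an \<open>N\<close> with small \<open>app g N\<close> may be too small itself. Induction on
      \<open>n\<close> raises it step by step, and \<open>g\<close> decreases on the way.\<close>
    have "\<exists>N\<in>elts zomega. n \<in> elts (zsucc N) \<and> app g N \<prec> x" using n
    proof (induction rule: zomega_induct)
      case def_pred
      show ?case by (intro definable)
    next
      case zempty
      obtain N where "N \<in> elts zomega" "app g N \<prec> x" using g(4)[OF x] by blast
      then show ?case using zempty_le[of "zsucc N"] zsucc_neq_zempty by (metis zsucc_in_zomega)
    next
      case (zsucc n)
      then obtain N where N: "N \<in> elts zomega" "n \<in> elts (zsucc N)" "app g N \<prec> x" by blast
      have "app g (zsucc N) \<prec> x"
        using less_le_trans[OF _ _ x(1) g(3)[OF N(1)]] N is_fun_app(1)[OF g(1)] by simp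
      moreover have "zsucc n \<in> elts (zsucc (zsucc N))"
        using zsucc_le[of "zsucc N" n] N by auto
      ultimately show ?case using N(1) zsucc_in_zomega by blast
    qed
    then obtain N j where "N \<in> elts zomega" "app g N \<prec> x" "j \<in> elts zomega" "app w j = opair n N"
      using w(2) by blast
    then show ?thesis using e(2) h(2) by (metis zfst_opair zsnd_opair)
  qed
  ultimately show ?thesis using e(1) h(1) by blast
qed

end

section \<open>Metric spaces and product spaces in the model\<close>

locale metric_model = reals R for R :: "'a::zf ofield" +
  fixes X d :: 'a
  assumes metric: "is_metric R X d"
begin

abbreviation dist where "dist x y \<equiv> app2 d x y"
abbreviation T where "T \<equiv> metric_topology R X d"

lemma dist_in [simp]: "x \<in> elts X \<Longrightarrow> y \<in> elts X \<Longrightarrow> dist x y \<in> K"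
  using metric unfolding is_metric_def
  by (intro is_fun_app(1)[of d "zTimes X X"]) auto

lemma dist_nonneg: "x \<in> elts X \<Longrightarrow> y \<in> elts X \<Longrightarrow> \<zero> \<preceq> dist x y"
  and dist_eq_zero: "x \<in> elts X \<Longrightarrow> y \<in> elts X \<Longrightarrow> dist x y = \<zero> \<longleftrightarrow> x = y"
  and dist_commute: "x \<in> elts X \<Longrightarrow> y \<in> elts X \<Longrightarrow> dist x y = dist y x"
  and triangle: "x \<in> elts X \<Longrightarrow> y \<in> elts X \<Longrightarrow> z \<in> elts X \<Longrightarrow> dist x z \<preceq> dist x y \<oplus> dist y z"
  using metric unfolding is_metric_def by blast+

lemma triangle_less:
  assumes "x \<in> elts X" "y \<in> elts X" "z \<in> elts X" "r \<in> K" "s \<in> K"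
    and "dist x y \<prec> r" "dist y z \<prec> s"
  shows "dist x z \<prec> r \<oplus> s"
  using le_less_trans[OF _ _ _ triangle[OF assms(1-3)] add_strict_mono[OF _ _ _ _ assms(6,7)]] assms
  by simp

section \<open>Balls, small sets and diameters\<close>

lemma elts_metric_topology: "elts T = {U. elts U \<subseteq> elts X \<and>
    (\<forall>x\<in>elts U. \<exists>r\<in>K. \<zero> \<prec> r \<and> (\<forall>y\<in>elts X. dist x y \<prec> r \<longrightarrow> y \<in> elts U))}"
  unfolding metric_topology_def
  by (rule elts_the_set_sep[of _ "zPow X"], intro definable) simp

lemma ex_ball:
  assumes x: "x \<in> elts X" and r: "r \<in> K"
  shows "\<exists>U\<in>elts T. elts U = {y \<in> elts X. dist x y \<prec> r}"
proof -
  have "\<exists>U. elts U = {y \<in> elts X. dist x y \<prec> r}" by (intro separation' definable)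
  then obtain U where U: "elts U = {y \<in> elts X. dist x y \<prec> r}" by blast
  have "\<exists>s\<in>K. \<zero> \<prec> s \<and> (\<forall>z\<in>elts X. dist y z \<prec> s \<longrightarrow> dist x z \<prec> r)"
    if y: "y \<in> elts X" "dist x y \<prec> r" for y
  proof -
    have xy: "dist x y \<in> K" using x y(1) by simp
    \<comment> \<open>\<open>w\<close> is the negative of the distance, so \<open>?s\<close> is the
      room that \<open>y\<close> has left inside the ball.\<close>
    obtain w where w: "w \<in> K" "dist x y \<oplus> w = \<zero>" using minus_ex[OF xy] by blast
    let ?s = "r \<oplus> w"
    have "dist x y \<oplus> ?s = dist x y \<oplus> (w \<oplus> r)" using add_commute[OF r w(1)] by simp
    then have eq: "dist x y \<oplus> ?s = r" using add_assoc[OF xy w(1) r] w(2) r by simp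
    have "\<zero> \<prec> ?s" using add_right_strict_mono[OF xy r w(1) y(2)] w(2) by simp
    moreover have "dist x z \<prec> r" if z: "z \<in> elts X" "dist y z \<prec> ?s" for z
    proof -
      have "dist x y \<oplus> dist y z \<prec> dist x y \<oplus> ?s"
        using add_right_strict_mono[of "dist y z" ?s "dist x y"] z xy y(1) w(1) r
          add_commute[OF xy, of "dist y z"] add_commute[OF xy, of ?s] by simp
      then show ?thesis
        using le_less_trans[OF _ _ _ triangle[OF x y(1) z(1)]] eq x y(1) z(1) r by simp
    qed
    ultimately show ?thesis using r w(1) by (intro bexI[of _ ?s]) simp_all
  qed
  then have "U \<in> elts T" unfolding elts_metric_topology using U by auto
  then show ?thesis using U by blast
qed

text \<open>A strict bound on all distances replaces the diameter, a supremum whose existence would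
  need proof each time and which the empty set does not have.\<close>

definition small :: "'a \<Rightarrow> 'a \<Rightarrow> bool" where
  "small U r \<longleftrightarrow> (\<forall>y\<in>elts U. \<forall>z\<in>elts U. dist y z \<prec> r)"

lemma def_pred_small [definable]:
  "def_term F \<Longrightarrow> def_term G \<Longrightarrow> def_pred (\<lambda>s. small (F s) (G s))"
  by (rule def_pred_subst2[of small]) (unfold small_def, intro definable)

lemma ex_small_base:
  assumes B: "is_base B T" and x: "x \<in> elts X" and r: "r \<in> K" "\<zero> \<prec> r"
  shows "\<exists>U\<in>elts B. x \<in> elts U \<and> small U r"
proof -
  \<comment> \<open>Two points in the ball of radius \<open>q\<close> about \<open>x\<close> have
    distance below \<open>q \<oplus> q\<close>, which is below \<open>r\<close>.\<close>
  obtain q where q: "q \<in> K" "\<zero> \<prec> q" "q \<oplus> (q \<oplus> q) \<prec> r" using ex_third[OF r] by blast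
  have "\<zero> \<prec> q \<oplus> q" using add_strict_mono[OF _ q(1) _ q(1) q(2) q(2)] by simp
  then have "q \<oplus> q \<prec> q \<oplus> (q \<oplus> q)" using add_right_strict_mono[of \<zero> q "q \<oplus> q"] q(1,2) by simp
  then have qr: "q \<oplus> q \<prec> r" using less_le_trans[of "q \<oplus> q" "q \<oplus> (q \<oplus> q)" r] q(1,3) r(1) by simp
  obtain V where V: "V \<in> elts T" "elts V = {y \<in> elts X. dist x y \<prec> q}" using ex_ball[OF x q(1)] by blast
  obtain S where S: "elts S \<subseteq> elts B" "zUnion S = V" using B V(1) unfolding is_base_def by blast
  have "x \<in> elts V" using V(2) x q(2) dist_eq_zero[OF x x] by simp
  then obtain U where U: "U \<in> elts S" "x \<in> elts U" using S(2) by auto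
  have UV: "elts U \<subseteq> elts V" using S(2) U(1) by auto
  have "small U r" unfolding small_def
  proof (intro ballI)
    fix y z assume "y \<in> elts U" "z \<in> elts U"
    then have yz: "y \<in> elts X" "z \<in> elts X" "dist y x \<prec> q" "dist x z \<prec> q"
      using UV V(2) dist_commute[OF x, of y] by auto
    show "dist y z \<prec> r"
      using less_le_trans[OF _ _ r(1) triangle_less[OF yz(1) x yz(2) q(1) q(1) yz(3,4)]] qr yz(1,2) q(1)
      by simp
  qed
  then show ?thesis using U S(1) by blast
qed

text \<open>Dedekind completeness turns a uniform bound into a diameter, the form that Cantor
  completeness asks for. A supremum preserves only weak inequalities, hence
  \<open>\<preceq>\<close>.\<close>

lemma ex_diameter:
  assumes A: "elts A \<subseteq> elts X" "elts A \<noteq> {}" and r: "r \<in> K" "small A r"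
  shows "\<exists>s\<in>K. is_diameter R d A s \<and> s \<preceq> r"
proof -
  let ?D = "{dist x y | x y. x \<in> elts A \<and> y \<in> elts A}"
  have "\<exists>S. elts S = {t \<in> K. \<exists>x y. t = dist x y \<and> x \<in> elts A \<and> y \<in> elts A}"
    by (intro separation' definable)
  then obtain S where "elts S = {t \<in> K. \<exists>x y. t = dist x y \<and> x \<in> elts A \<and> y \<in> elts A}" by blast
  then have S: "elts S = ?D" using A(1) by (auto intro!: dist_in)
  then have bound: "\<forall>x\<in>elts S. x \<preceq> r" using r(2) unfolding small_def by auto
  have "elts S \<subseteq> K" using S A(1) by (auto intro!: dist_in)
  moreover have "elts S \<noteq> {}" using S A(2) by blast
  ultimately obtain s where s: "is_lub R (elts S) s" using reals bound r(1) unfolding is_reals_def by blast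
  then have "s \<in> K" "s \<preceq> r" using bound r(1) unfolding is_lub_def by blast+
  then show ?thesis using s S unfolding is_diameter_def by auto
qed

end

text \<open>Replaces \<open>bij_betw\<close> by quantifiers bounded by sets of the model, to which
  the rules in \<open>definable\<close> apply.\<close>

lemma is_bij_iff: "is_bij f A B \<longleftrightarrow> is_fun f A B \<and>
    (\<forall>x\<in>elts A. \<forall>y\<in>elts A. app f x = app f y \<longrightarrow> x = y) \<and>
    (\<forall>y\<in>elts B. \<exists>x\<in>elts A. app f x = y)"
proof (cases "is_fun f A B")
  case True
  then have "app f ` elts A \<subseteq> elts B" using is_fun_app(1)[OF True] by blast
  then have "app f ` elts A = elts B \<longleftrightarrow> elts B \<subseteq> app f ` elts A" by blast
  also have "\<dots> \<longleftrightarrow> (\<forall>y\<in>elts B. \<exists>x\<in>elts A. app f x = y)"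
    unfolding subset_iff image_iff by metis
  finally have "app f ` elts A = elts B \<longleftrightarrow> (\<forall>y\<in>elts B. \<exists>x\<in>elts A. app f x = y)" .
  then show ?thesis using True by (simp add: is_bij_def bij_betw_def inj_on_def)
qed (simp add: is_bij_def)

lemma def_pred_zfinite [definable]: "def_term F \<Longrightarrow> def_pred (\<lambda>s. zfinite (F s))"
  by (rule def_pred_subst1[of zfinite]) (unfold zfinite_def is_bij_iff, intro definable)

section \<open>The power, boxes and the product topology\<close>

lemma elts_omega_power: "elts (omega_power X) = {f. is_fun f zomega X}"
  unfolding omega_power_def
  by (rule elts_the_set_sep[of _ "zPow (zTimes zomega X)"], intro definable)
    (simp only: is_fun_def elts_zPow mem_Collect_eq)

lemma elts_box:
  "elts (box X V) = {f. is_fun f zomega X \<and> (\<forall>n\<in>elts zomega. app f n \<in> elts (app V n))}"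
  unfolding box_def
  by (rule elts_the_set_sep[of _ "omega_power X"], intro definable) (simp add: elts_omega_power)

lemma def_term_box [definable]: "def_term F \<Longrightarrow> def_term (\<lambda>s. box X (F s))"
  by (rule def_term_subst1[of "box X"]) (unfold box_def, intro definable)

lemma def_pred_is_box_family [definable]: "def_term F \<Longrightarrow> def_pred (\<lambda>s. is_box_family X T (F s))"
  by (rule def_pred_subst1[of "is_box_family X T"]) (unfold is_box_family_def, intro definable)

lemma elts_product_topology: "elts (product_topology X T) = {U. elts U \<subseteq> elts (omega_power X) \<and>
    (\<forall>f\<in>elts U. \<exists>V. is_box_family X T V \<and> f \<in> elts (box X V) \<and> elts (box X V) \<subseteq> elts U)}"
  unfolding product_topology_def
  by (rule elts_the_set_sep[of _ "zPow (omega_power X)"], intro definable) simp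

section \<open>Selecting a point of a closed set\<close>

text \<open>The base, its enumeration and the schedule are fixed before any closed set is
  considered. They enter as parameters, so one formula selects a point from every closed
  set.\<close>

locale selection = metric_model R X d for R :: "'a::zf ofield" and X d :: 'a +
  fixes B idx e h :: 'a
  assumes complete: "cantor_complete R X d"
    and base: "is_base B T"
    and idx: "is_inj idx B zomega"
    and e: "is_fun e zomega zomega"
    and h: "is_fun h zomega (rcar R)"
    and h_pos: "\<And>j. j \<in> elts zomega \<Longrightarrow> \<zero> \<prec> app h j"
    and schedule: "\<And>n x. n \<in> elts zomega \<Longrightarrow> x \<in> K \<Longrightarrow> \<zero> \<prec> x \<Longrightarrow>
      \<exists>j\<in>elts zomega. app e j = n \<and> app h j \<prec> x"
begin

definition admissible :: "'a \<Rightarrow> 'a \<Rightarrow> 'a \<Rightarrow> bool" where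
  "admissible j S U \<longleftrightarrow> U \<in> elts B \<and> small U (app h j) \<and> (\<exists>f\<in>elts S. app f (app e j) \<in> elts U)"

text \<open>Inclusion is the order of \<open>zomega\<close>, so \<open>U\<close> has least index. As
  \<open>idx\<close> is injective, at most one \<open>U\<close> qualifies and the existential
  quantifier hides no choice.\<close>

definition refine :: "'a \<Rightarrow> 'a \<Rightarrow> 'a" where
  "refine j S = the_set {f. f \<in> elts S \<and> (\<exists>U. admissible j S U \<and>
    (\<forall>V. admissible j S V \<longrightarrow> elts (app idx U) \<subseteq> elts (app idx V)) \<and> app f (app e j) \<in> elts U)}"

text \<open>The closure of the \<open>n\<close>-th projection of \<open>S\<close>.\<close>

definition shadow :: "'a \<Rightarrow> 'a \<Rightarrow> 'a" where
  "shadow n S = the_set {x. x \<in> elts X \<and>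
    (\<forall>V\<in>elts T. x \<in> elts V \<longrightarrow> (\<exists>f\<in>elts S. app f n \<in> elts V))}"

definition refinement :: "'a \<Rightarrow> 'a \<Rightarrow> bool" where
  "refinement F S \<longleftrightarrow> is_fun S zomega (zPow (omega_power X)) \<and> app S zempty = F \<and>
    (\<forall>j\<in>elts zomega. app S (zsucc j) = refine j (app S j))"

text \<open>The formula behind the choice function. \<open>S\<close> is determined by
  \<open>F\<close>, and the coordinates of \<open>p\<close> by \<open>S\<close>, so it is
  single-valued for nonempty \<open>F\<close>.\<close>

definition selected :: "'a \<Rightarrow> 'a \<Rightarrow> bool" where
  "selected F p \<longleftrightarrow> is_fun p zomega X \<and> (\<exists>S. refinement F S \<and>
    (\<forall>n\<in>elts zomega. \<forall>j\<in>elts zomega. app p n \<in> elts (shadow n (app S j))))"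

lemma def_pred_admissible [definable]:
  "def_term F \<Longrightarrow> def_term G \<Longrightarrow> def_term H \<Longrightarrow> def_pred (\<lambda>s. admissible (F s) (G s) (H s))"
  by (rule def_pred_subst3[of admissible]) (unfold admissible_def, intro definable)

lemma def_term_refine [definable]:
  "def_term F \<Longrightarrow> def_term G \<Longrightarrow> def_term (\<lambda>s. refine (F s) (G s))"
  by (rule def_term_subst2[of refine]) (unfold refine_def, intro definable)

lemma def_term_shadow [definable]:
  "def_term F \<Longrightarrow> def_term G \<Longrightarrow> def_term (\<lambda>s. shadow (F s) (G s))"
  by (rule def_term_subst2[of shadow]) (unfold shadow_def, intro definable)

lemma def_pred_selected: "def_pred (\<lambda>s. selected (s 0) (s (Suc 0)))"
  unfolding selected_def refinement_def by (intro definable)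

lemma elts_refine: "elts (refine j S) = {f. f \<in> elts S \<and> (\<exists>U. admissible j S U \<and>
    (\<forall>V. admissible j S V \<longrightarrow> elts (app idx U) \<subseteq> elts (app idx V)) \<and> app f (app e j) \<in> elts U)}"
  unfolding refine_def by (rule elts_the_set_sep[of _ S], intro definable) blast

lemma elts_shadow: "elts (shadow n S) = {x. x \<in> elts X \<and>
    (\<forall>V\<in>elts T. x \<in> elts V \<longrightarrow> (\<exists>f\<in>elts S. app f n \<in> elts V))}"
  unfolding shadow_def by (rule elts_the_set_sep[of _ X], intro definable) blast

lemma refine_subset: "elts (refine j S) \<subseteq> elts S"
  unfolding elts_refine by blast

text \<open>A small basic neighbourhood of the relevant coordinate of any member of \<open>S\<close>
  is admissible. So a least admissible index exists, and admissibility of its basic set provides a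
  member that survives.\<close>

lemma refine_nonempty:
  assumes j: "j \<in> elts zomega" and S: "elts S \<subseteq> elts (omega_power X)" "elts S \<noteq> {}"
  shows "elts (refine j S) \<noteq> {}"
proof -
  have idx_in: "app idx U \<in> elts zomega" if "U \<in> elts B" for U
    using idx is_fun_app(1) that unfolding is_inj_def by blast
  obtain f where f: "f \<in> elts S" using S(2) by blast
  then have "is_fun f zomega X" using S(1) by (auto simp: elts_omega_power)
  then have "app f (app e j) \<in> elts X" using is_fun_app(1) is_fun_app(1)[OF e j] by blast
  then obtain U where "U \<in> elts B" "app f (app e j) \<in> elts U" "small U (app h j)"
    using ex_small_base[OF base] is_fun_app(1)[OF h j] h_pos[OF j] by blast
  then have "admissible j S U" unfolding admissible_def using f by blast
  moreover have "def_pred (\<lambda>s. \<exists>U. admissible j S U \<and> s 0 = app idx U)" by (intro definable)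
  ultimately obtain n where "\<exists>U. admissible j S U \<and> n = app idx U"
      "\<forall>m\<in>elts zomega. (\<exists>V. admissible j S V \<and> m = app idx V) \<longrightarrow> elts n \<subseteq> elts m"
    using zomega_least[of "\<lambda>n. \<exists>U. admissible j S U \<and> n = app idx U" "app idx U"]
      idx_in[OF \<open>U \<in> elts B\<close>] by blast
  then obtain U where U: "admissible j S U"
      "\<And>V. admissible j S V \<Longrightarrow> elts (app idx U) \<subseteq> elts (app idx V)"
    using idx_in unfolding admissible_def by blast
  then obtain g where "g \<in> elts S" "app g (app e j) \<in> elts U" unfolding admissible_def by blast
  then have "g \<in> elts (refine j S)" unfolding elts_refine using U by blast
  then show ?thesis by blast
qed

text \<open>Both coordinates lie in one small basic set: two admissible sets of least index have
  equal indices by extensionality and coincide by injectivity.\<close>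

lemma refine_small:
  assumes "j \<in> elts zomega" "f \<in> elts (refine j S)" "g \<in> elts (refine j S)"
  shows "dist (app f (app e j)) (app g (app e j)) \<prec> app h j"
proof -
  obtain U V where U: "admissible j S U" "app f (app e j) \<in> elts U"
    and V: "admissible j S V" "app g (app e j) \<in> elts V"
    and "elts (app idx U) \<subseteq> elts (app idx V)" "elts (app idx V) \<subseteq> elts (app idx U)"
    using assms(2,3) unfolding elts_refine by blast
  then have "app idx U = app idx V" using elts_inject[of "app idx U" "app idx V"] by blast
  then have "U = V" using idx U(1) V(1) unfolding is_inj_def admissible_def by (meson inj_onD)
  then show ?thesis using U V unfolding admissible_def small_def by blast
qed

lemma shadow_subset: "elts (shadow n S) \<subseteq> elts X"
  unfolding elts_shadow by blast

lemma app_in_shadow: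
  "n \<in> elts zomega \<Longrightarrow> f \<in> elts S \<Longrightarrow> is_fun f zomega X \<Longrightarrow> app f n \<in> elts (shadow n S)"
  unfolding elts_shadow using is_fun_app(1) by blast

lemma shadow_mono: "elts S \<subseteq> elts S' \<Longrightarrow> elts (shadow n S) \<subseteq> elts (shadow n S')"
  unfolding elts_shadow by blast

text \<open>An open \<open>V\<close> that excludes one point from the shadow excludes all of its own
  points, hence a whole ball.\<close>

lemma shadow_closed: "is_closed X T (shadow n S)"
proof -
  have "\<exists>r\<in>K. \<zero> \<prec> r \<and> (\<forall>z\<in>elts X. dist y z \<prec> r \<longrightarrow> z \<notin> elts (shadow n S))"
    if y: "y \<in> elts X" "y \<notin> elts (shadow n S)" for y
  proof -
    obtain V where V: "V \<in> elts T" "y \<in> elts V" "\<not> (\<exists>f\<in>elts S. app f n \<in> elts V)"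
      using y unfolding elts_shadow by blast
    then obtain r where "r \<in> K" "\<zero> \<prec> r" "\<forall>z\<in>elts X. dist y z \<prec> r \<longrightarrow> z \<in> elts V"
      unfolding elts_metric_topology by blast
    moreover have "z \<notin> elts (shadow n S)" if "z \<in> elts V" for z
      using V(1,3) that unfolding elts_shadow by blast
    ultimately show ?thesis by blast
  qed
  then show ?thesis unfolding is_closed_def elts_metric_topology using shadow_subset by auto
qed

text \<open>Each point of the closure has an actual coordinate within \<open>r\<close>, so the
  closure costs one further \<open>r\<close> at either end.\<close>

lemma shadow_small:
  assumes S: "elts S \<subseteq> elts (omega_power X)" and n: "n \<in> elts zomega" and r: "r \<in> K" "\<zero> \<prec> r"
    and fg: "\<And>f g. f \<in> elts S \<Longrightarrow> g \<in> elts S \<Longrightarrow> dist (app f n) (app g n) \<prec> r"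
  shows "small (shadow n S) (r \<oplus> (r \<oplus> r))"
  unfolding small_def
proof (intro ballI)
  have near: "\<exists>f\<in>elts S. app f n \<in> elts X \<and> dist x (app f n) \<prec> r" if shadow: "x \<in> elts (shadow n S)" for x
  proof -
    have x: "x \<in> elts X" using shadow shadow_subset by blast
    obtain U where U: "U \<in> elts T" "elts U = {y \<in> elts X. dist x y \<prec> r}" using ex_ball[OF x r(1)] by blast
    then have "x \<in> elts U" using x r(2) dist_eq_zero[OF x x] by simp
    then obtain f where "f \<in> elts S" "app f n \<in> elts U" using shadow U(1) unfolding elts_shadow by blast
    then show ?thesis using U(2) by blast
  qed
  fix x y assume xy: "x \<in> elts (shadow n S)" "y \<in> elts (shadow n S)"
  then have xX: "x \<in> elts X" and yX: "y \<in> elts X" using shadow_subset by blast+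
  obtain f where f: "f \<in> elts S" "app f n \<in> elts X" "dist x (app f n) \<prec> r" using near xy(1) by blast
  obtain g where g: "g \<in> elts S" "app g n \<in> elts X" "dist y (app g n) \<prec> r" using near xy(2) by blast
  have "dist (app g n) y \<prec> r" using g dist_commute[OF yX g(2)] by simp
  then have "dist (app f n) y \<prec> r \<oplus> r"
    using triangle_less[OF f(2) g(2) yX r(1) r(1) fg[OF f(1) g(1)]] by blast
  then show "dist x y \<prec> r \<oplus> (r \<oplus> r)"
    using triangle_less[OF xX f(2) yX r(1) _ f(3)] r(1) by simp
qed

section \<open>The decreasing sequence of subsets and its limit\<close>

lemma ex_refinement:
  assumes "elts F \<subseteq> elts (omega_power X)" shows "\<exists>S. refinement F S"
  unfolding refinement_def
proof (rule ex_recursive_fun)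
  show "def_term (\<lambda>s. refine (s 0) (s (Suc 0)))" by (intro definable)
  show "refine j q \<in> elts (zPow (omega_power X))" if "q \<in> elts (zPow (omega_power X))" for j q
    using that refine_subset[of j q] by auto
qed (use assms in simp)

lemma refinement_unique: "refinement F S \<Longrightarrow> refinement F S' \<Longrightarrow> S = S'"
  unfolding refinement_def by (intro recursive_fun_unique[of S _ refine]) auto

context
  fixes F S
  assumes S: "refinement F S" and F: "elts F \<noteq> {}"
begin

lemma refinement_subset: "j \<in> elts zomega \<Longrightarrow> elts (app S j) \<subseteq> elts (omega_power X)"
  using is_fun_app(1)[of S zomega "zPow (omega_power X)" j] S unfolding refinement_def by simp

lemma refinement_zsucc: "j \<in> elts zomega \<Longrightarrow> app S (zsucc j) = refine j (app S j)"
  using S unfolding refinement_def by blast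

lemma refinement_nonempty: "j \<in> elts zomega \<Longrightarrow> elts (app S j) \<noteq> {}"
proof (induction rule: zomega_induct)
  case def_pred
  have "def_pred (\<lambda>s. \<exists>f. f \<in> elts (app S (s 0)))" by (intro definable)
  then show ?case by (simp add: ex_in_conv)
next
  case zempty
  then show ?case using S F unfolding refinement_def by simp
next
  case (zsucc j)
  then show ?case using refine_nonempty refinement_zsucc refinement_subset by simp
qed

lemma refinement_antimono:
  assumes "i \<in> elts zomega" "j \<in> elts zomega" "elts i \<subseteq> elts j"
  shows "elts (app S j) \<subseteq> elts (app S i)"
proof -
  have "elts i \<subseteq> elts j \<longrightarrow> elts (app S j) \<subseteq> elts (app S i)" using assms(2)
  proof (induction rule: zomega_induct)
    case def_pred
    show ?case by (intro definable)
  next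
    case zempty
    then show ?case using elts_inject[of i zempty] by auto
  next
    case (zsucc j)
    then show ?case
      using zomega_le_zsucc[OF zsucc(1) assms(1)] refine_subset[of j "app S j"] refinement_zsucc
      by auto
  qed
  then show ?thesis using assms(3) by blast
qed

lemma refinement_small:
  assumes n: "n \<in> elts zomega" and x: "x \<in> K" "\<zero> \<prec> x"
  shows "\<exists>j\<in>elts zomega. small (shadow n (app S j)) x"
proof -
  obtain r where r: "r \<in> K" "\<zero> \<prec> r" "r \<oplus> (r \<oplus> r) \<prec> x" using ex_third[OF x] by blast
  obtain j where j: "j \<in> elts zomega" "app e j = n" "app h j \<prec> r" using schedule[OF n r(1,2)] by blast
  \<comment> \<open>The cut scheduled at \<open>j\<close> takes effect in passing to the next set,
    so smallness holds at \<open>zsucc j\<close>, not at \<open>j\<close>.\<close>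
  have "small (shadow n (app S (zsucc j))) (r \<oplus> (r \<oplus> r))"
  proof (rule shadow_small[OF refinement_subset n r(1,2)])
    fix f g assume fg: "f \<in> elts (app S (zsucc j))" "g \<in> elts (app S (zsucc j))"
    then have "is_fun f zomega X" "is_fun g zomega X"
      using refinement_subset[of "zsucc j"] j(1) by (auto simp: elts_omega_power)
    then have X: "app f n \<in> elts X" "app g n \<in> elts X" using is_fun_app(1) n by blast+
    have "dist (app f n) (app g n) \<prec> app h j"
      using refine_small[OF j(1)] fg refinement_zsucc[OF j(1)] j(2) by simp
    then show "dist (app f n) (app g n) \<prec> r"
      using less_le_trans[OF _ _ _ _ conjunct1[OF j(3)]] X is_fun_app(1)[OF h j(1)] r(1) by simp
  qed (use j in simp)
  then have "small (shadow n (app S (zsucc j))) x"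
    unfolding small_def using less_le_trans[OF _ _ x(1) _ conjunct1[OF r(3)]] r(1) shadow_subset
      dist_in add_in by (meson subsetD)
  then show ?thesis using j(1) zsucc_in_zomega by blast
qed

text \<open>A shadow whose distances are all below \<open>dist x y\<close> cannot contain both
  points.\<close>

lemma limit_unique:
  assumes n: "n \<in> elts zomega"
    and "\<And>j. j \<in> elts zomega \<Longrightarrow> x \<in> elts (shadow n (app S j))"
    and "\<And>j. j \<in> elts zomega \<Longrightarrow> y \<in> elts (shadow n (app S j))"
  shows "x = y"
proof (rule ccontr)
  assume "x \<noteq> y"
  have X: "x \<in> elts X" "y \<in> elts X" using assms(2,3) shadow_subset zempty_in_zomega by blast+
  then have "dist x y \<in> K" "\<zero> \<prec> dist x y"
    using dist_nonneg dist_eq_zero[OF X] \<open>x \<noteq> y\<close> by force+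
  then obtain j where "j \<in> elts zomega" "small (shadow n (app S j)) (dist x y)"
    using refinement_small[OF n] by blast
  then show False using assms(2,3) unfolding small_def by blast
qed

text \<open>Definability of \<open>shadow\<close> makes the shadows a sequence of the model, as
  Cantor completeness requires. Smallness reached at one stage is inherited by all later ones, which
  gives the limit of the diameters.\<close>

lemma ex_limit:
  assumes n: "n \<in> elts zomega"
  shows "\<exists>x. \<forall>j\<in>elts zomega. x \<in> elts (shadow n (app S j))"
proof -
  have "\<exists>A. is_fun A zomega (zPow X) \<and> (\<forall>j\<in>elts zomega. app A j = shadow n (app S j))"
    using shadow_subset by (intro ex_fun definable) simp
  then obtain A where A: "is_fun A zomega (zPow X)"
      "\<And>j. j \<in> elts zomega \<Longrightarrow> app A j = shadow n (app S j)" by blast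
  have nonempty: "elts (shadow n (app S j)) \<noteq> {}" if j: "j \<in> elts zomega" for j
  proof -
    obtain f where f: "f \<in> elts (app S j)" using refinement_nonempty[OF j] by blast
    then have "is_fun f zomega X" using refinement_subset[OF j] by (auto simp: elts_omega_power)
    then show ?thesis using app_in_shadow[OF n f] by blast
  qed
  have "diameters_tendsto_zero R d A" unfolding diameters_tendsto_zero_def
  proof (intro ballI impI)
    fix x assume x: "x \<in> K" "\<zero> \<prec> x"
    \<comment> \<open>Halving leaves room for strictness: the diameter is only
      \<open>\<preceq>\<close> its bound \<open>y\<close>.\<close>
    obtain y where "y \<in> K" "y \<oplus> y = x" using ex_half x(1) by blast
    then have y: "y \<in> K" "\<zero> \<prec> y" "y \<prec> x" using half_pos[of y] x by auto
    obtain m where m: "m \<in> elts zomega" "small (shadow n (app S m)) y"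
      using refinement_small[OF n y(1,2)] by blast
    have "\<exists>r. is_diameter R d (app A j) r \<and> r \<prec> x" if j: "j \<in> elts zomega" "elts m \<subseteq> elts j" for j
    proof -
      have "elts (shadow n (app S j)) \<subseteq> elts (shadow n (app S m))"
        using shadow_mono refinement_antimono[OF m(1) j] by blast
      then have "small (shadow n (app S j)) y" using m(2) unfolding small_def by blast
      then obtain r where "r \<in> K" "is_diameter R d (shadow n (app S j)) r" "r \<preceq> y"
        using ex_diameter[OF shadow_subset nonempty[OF j(1)] y(1)] by blast
      then show ?thesis using le_less_trans[OF _ y(1) x(1) _ y(3)] A(2)[OF j(1)] by metis
    qed
    then show "\<exists>m\<in>elts zomega. \<forall>j\<in>elts zomega. elts m \<subseteq> elts j \<longrightarrow>
        (\<exists>r. is_diameter R d (app A j) r \<and> r \<prec> x)" using m(1) by blast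
  qed
  moreover have "app A j \<noteq> zempty \<and> is_closed X T (app A j) \<and> elts (app A (zsucc j)) \<subseteq> elts (app A j)"
    if j: "j \<in> elts zomega" for j
  proof -
    have "elts (shadow n (app S (zsucc j))) \<subseteq> elts (shadow n (app S j))"
      using shadow_mono refine_subset refinement_zsucc[OF j] by simp
    then show ?thesis using A(2) j nonempty[OF j] shadow_closed by auto
  qed
  ultimately have "(\<Inter>j\<in>elts zomega. elts (app A j)) \<noteq> {}"
    using complete A(1) unfolding cantor_complete_def by blast
  then show ?thesis using A(2) by auto
qed

text \<open>\<open>x\<close> and the coordinates of all members of \<open>app S j\<close> lie in one
  shadow; once it is small, all these coordinates are near \<open>x\<close>.\<close>

lemma limit_neighbourhood:
  assumes n: "n \<in> elts zomega" and x: "\<And>j. j \<in> elts zomega \<Longrightarrow> x \<in> elts (shadow n (app S j))"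
    and U: "U \<in> elts T" "x \<in> elts U"
  shows "\<exists>j\<in>elts zomega. \<forall>f\<in>elts (app S j). app f n \<in> elts U"
proof -
  obtain r where r: "r \<in> K" "\<zero> \<prec> r" "\<forall>y\<in>elts X. dist x y \<prec> r \<longrightarrow> y \<in> elts U"
    using U unfolding elts_metric_topology by blast
  obtain j where j: "j \<in> elts zomega" "small (shadow n (app S j)) r"
    using refinement_small[OF n r(1,2)] by blast
  have "app f n \<in> elts U" if f: "f \<in> elts (app S j)" for f
  proof -
    have "is_fun f zomega X" using f refinement_subset[OF j(1)] by (auto simp: elts_omega_power)
    then have "app f n \<in> elts (shadow n (app S j))" using app_in_shadow[OF n f] by blast
    then show ?thesis using j x[OF j(1)] r(3) shadow_subset unfolding small_def by blast
  qed
  then show ?thesis using j(1) by blast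
qed

lemma limit_in_closed:
  assumes closed: "is_closed (omega_power X) (product_topology X T) F"
    and p: "is_fun p zomega X"
    and lim: "\<And>n j. n \<in> elts zomega \<Longrightarrow> j \<in> elts zomega \<Longrightarrow> app p n \<in> elts (shadow n (app S j))"
  shows "p \<in> elts F"
proof (rule ccontr)
  assume "p \<notin> elts F"
  then have "p \<in> elts (zDiff (omega_power X) F)" using p by (simp add: elts_omega_power)
  then obtain V where V: "is_box_family X T V" "p \<in> elts (box X V)"
      "elts (box X V) \<subseteq> elts (zDiff (omega_power X) F)"
    using closed unfolding is_closed_def elts_product_topology by blast
  have V_fun: "is_fun V zomega T" using V(1) unfolding is_box_family_def by blast
  define N where "N = the_set {n \<in> elts zomega. app V n \<noteq> X}"
  have N: "elts N = {n \<in> elts zomega. app V n \<noteq> X}"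
    unfolding N_def by (rule elts_the_set_sep[of _ zomega], intro definable) blast
  obtain m b where m: "m \<in> elts zomega" and b: "is_bij b m N"
    using V(1) unfolding is_box_family_def zfinite_def N_def by blast
  have bN: "app b i \<in> elts zomega" if "i \<in> elts m" for i
    using b is_fun_app(1) that N unfolding is_bij_iff by blast
  \<comment> \<open>Finiteness is internal and \<open>m\<close> may be nonstandard, so the
    restricted coordinates are treated by induction on initial segments \<open>k\<close> of
    \<open>m\<close>, with a definable claim.\<close>
  have "elts k \<subseteq> elts m \<longrightarrow> (\<exists>j\<in>elts zomega. \<forall>i\<in>elts k. \<forall>f\<in>elts (app S j).
      app f (app b i) \<in> elts (app V (app b i)))" if "k \<in> elts zomega" for k
    using that
  proof (induction rule: zomega_induct)
    case def_pred
    show ?case by (intro definable)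
  next
    case zempty
    show ?case by (intro impI bexI[OF _ zempty_in_zomega]) simp
  next
    case (zsucc k)
    show ?case
    proof
      assume sub: "elts (zsucc k) \<subseteq> elts m"
      then obtain j where j: "j \<in> elts zomega" "\<And>i f. i \<in> elts k \<Longrightarrow> f \<in> elts (app S j) \<Longrightarrow>
          app f (app b i) \<in> elts (app V (app b i))" using zsucc(2) by auto
      have bk: "app b k \<in> elts zomega" using bN sub by simp
      then obtain j' where j': "j' \<in> elts zomega"
          "\<And>f. f \<in> elts (app S j') \<Longrightarrow> app f (app b k) \<in> elts (app V (app b k))"
        using limit_neighbourhood[OF bk lim[OF bk] is_fun_app(1)[OF V_fun bk]] V(2)
        by (auto simp: elts_box)
      \<comment> \<open>The later of the two stages serves the old coordinates and the new one,
        since the sets decrease.\<close>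
      obtain l where l: "l \<in> elts zomega" "elts j \<subseteq> elts l" "elts j' \<subseteq> elts l"
        using zomega_linear[OF j(1) j'(1)] j(1) j'(1) by blast
      have "elts (app S l) \<subseteq> elts (app S j)" "elts (app S l) \<subseteq> elts (app S j')"
        using refinement_antimono j(1) j'(1) l by blast+
      then show "\<exists>j\<in>elts zomega. \<forall>i\<in>elts (zsucc k). \<forall>f\<in>elts (app S j).
          app f (app b i) \<in> elts (app V (app b i))"
        using j(2) j'(2) by (intro bexI[OF _ l(1)]) auto
    qed
  qed
  from this[OF m] obtain j where j: "j \<in> elts zomega" "\<And>i f. i \<in> elts m \<Longrightarrow> f \<in> elts (app S j) \<Longrightarrow>
      app f (app b i) \<in> elts (app V (app b i))" by blast
  obtain f where f: "f \<in> elts (app S j)" using refinement_nonempty[OF j(1)] by blast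
  have f_fun: "is_fun f zomega X" using f refinement_subset[OF j(1)] by (auto simp: elts_omega_power)
  have "app f n \<in> elts (app V n)" if n: "n \<in> elts zomega" for n
  proof (cases "n \<in> elts N")
    case True
    then obtain i where "i \<in> elts m" "app b i = n" using b unfolding is_bij_iff by blast
    then show ?thesis using j(2)[OF _ f] by blast
  next
    case False
    then show ?thesis using N n is_fun_app(1)[OF f_fun n] by simp
  qed
  then have "f \<in> elts (box X V)" using f_fun by (simp add: elts_box)
  moreover have "f \<in> elts F"
    using f refinement_antimono[OF zempty_in_zomega j(1)] S unfolding refinement_def by auto
  ultimately show False using V(3) by auto
qed

end

section \<open>The selected point yields the choice function\<close>

lemma ex_selected:
  assumes F: "is_closed (omega_power X) (product_topology X T) F" "F \<noteq> zempty"
  shows "\<exists>p\<in>elts F. selected F p"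
proof -
  have nonempty: "elts F \<noteq> {}" using F(2) elts_inject[of F zempty] by simp
  obtain S where S: "refinement F S" using ex_refinement F(1) unfolding is_closed_def by blast
  \<comment> \<open>The limits are collected into one point by \<open>ex_fun_rel\<close>; their
    uniqueness makes this possible without choosing coordinates.\<close>
  have "\<exists>p. is_fun p zomega X \<and>
      (\<forall>n\<in>elts zomega. \<forall>j\<in>elts zomega. app p n \<in> elts (shadow n (app S j)))"
  proof (rule ex_fun_rel)
    show "def_pred (\<lambda>s. \<forall>j\<in>elts zomega. s (Suc 0) \<in> elts (shadow (s 0) (app S j)))"
      by (intro definable)
    show "\<exists>x\<in>elts X. \<forall>j\<in>elts zomega. x \<in> elts (shadow n (app S j))" if "n \<in> elts zomega" for n
      using ex_limit[OF S nonempty that] shadow_subset zempty_in_zomega by blast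
  qed (use limit_unique[OF S nonempty] in blast)
  then obtain p where "is_fun p zomega X"
      "\<And>n j. n \<in> elts zomega \<Longrightarrow> j \<in> elts zomega \<Longrightarrow> app p n \<in> elts (shadow n (app S j))" by blast
  then show ?thesis using limit_in_closed[OF S nonempty F(1)] S unfolding selected_def by blast
qed

lemma selected_unique:
  assumes F: "F \<noteq> zempty" and p: "selected F p" and q: "selected F q"
  shows "p = q"
proof -
  have nonempty: "elts F \<noteq> {}" using F elts_inject[of F zempty] by simp
  obtain S where S: "refinement F S" "is_fun p zomega X"
      "\<And>n j. n \<in> elts zomega \<Longrightarrow> j \<in> elts zomega \<Longrightarrow> app p n \<in> elts (shadow n (app S j))"
    using p unfolding selected_def by blast
  \<comment> \<open>The refinement sequence behind \<open>q\<close> must be the same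
    \<open>S\<close>, so both points have coordinates in the same shadows.\<close>
  then have q': "is_fun q zomega X"
      "\<And>n j. n \<in> elts zomega \<Longrightarrow> j \<in> elts zomega \<Longrightarrow> app q n \<in> elts (shadow n (app S j))"
    using q refinement_unique unfolding selected_def by blast+
  show ?thesis
    by (rule is_fun_ext[OF S(2) q'(1)]) (use limit_unique[OF S(1) nonempty] S(3) q'(2) in blast)
qed

lemma loeb_omega_power: "loeb (omega_power X) (product_topology X T)"
proof -
  let ?C = "the_set {F. is_closed (omega_power X) (product_topology X T) F \<and> F \<noteq> zempty}"
  have "elts ?C = {F. is_closed (omega_power X) (product_topology X T) F \<and> F \<noteq> zempty}"
    unfolding is_closed_def
    by (rule elts_the_set_sep[of _ "zPow (omega_power X)"], intro definable) simp
  then have "\<exists>c. is_choice_function c ?C"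
    by (intro ex_choice_function[OF def_pred_selected]) (use ex_selected selected_unique in auto)
  then show ?thesis unfolding loeb_def by blast
qed

end

theorem theorem2p2:
  fixes X T :: "'a::zf"
  assumes "is_topology X T"
    and "cantor_completely_metrizable X T"
    and "second_countable T"
  shows "loeb (omega_power X) (product_topology X T)"
proof -
  obtain R d where R: "is_reals R" and d: "is_metric R X d" "cantor_complete R X d"
    and T: "metric_topology R X d = T"
    using assms(2) unfolding cantor_completely_metrizable_def by blast
  obtain B idx where B: "is_base B T" "is_inj idx B zomega"
    using assms(3) unfolding second_countable_def zcountable_def by blast
  interpret metric_model R X d using R d(1) by unfold_locales
  obtain e h where "is_fun e zomega zomega" "is_fun h zomega (rcar R)"
      "\<forall>j\<in>elts zomega. rless R (rzero R) (app h j)"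
      "\<forall>n\<in>elts zomega. \<forall>x\<in>elts (rcar R). rless R (rzero R) x \<longrightarrow>
        (\<exists>j\<in>elts zomega. app e j = n \<and> rless R (app h j) x)"
    using ex_schedule by blast
  then interpret selection R X d B idx e h
    using d(2) B T by unfold_locales auto
  show ?thesis using loeb_omega_power T by simp
qed

end
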